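(* Let $K$ be a field, let $n\ge 2$ be an integer, let $S=K[x_1,\ldots,x_n]$, and let $I_3(P_n^2)\subseteq S$ be the 3-path ideal of the square $P_n^2$ of the path on $n$ vertices. Then $$\operatorname{depth}(S/I_3(P_n^2))=\left\lceil \frac{n}{7}\right\rceil+\left\lfloor \frac{n-2}{7}\right\rfloor+1.$$
   Context: $P_n^2$ (the square of the path $P_n$) is the simple graph on the vertex set $\{1,\ldots,n\}$ in which, for $1\le i<j\le n$, $\{i,j\}$ is an edge if and only if $0<j-i\le 2$. For a finite simple graph $G$ on $\{1,\ldots,n\}$, the 3-path ideal $I_3(G)\subseteq S=K[x_1,\ldots,x_n]$ is the ideal generated by all monomials $x_ax_bx_c$ such that $a,b,c$ are distinct vertices forming a path with 3 vertices in $G$ (i.e. $\{a,b\}$ and $\{b,c\}$ are edges of $G$). Explicitly, $I_3(P_n^2)$ is generated by all monomials of the forms $x_ix_{i+1}x_{i+2}$, $x_ix_{i+1}x_{i+3}$, $x_ix_{i+2}x_{i+3}$, $x_ix_{i+2}x_{i+4}$ ($i\ge 1$) all of whose indices are at most $n$; it is the zero ideal if there are none. For a homogeneous ideal $I\subseteq S$, $\operatorname{depth}(S/I)$ denotes the depth with respect to the graded maximal ideal $(x_1,\ldots,x_n)$. *)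

theory Defs
  imports "HOL-Algebra.Module" "HOL-Algebra.QuotRing" "HOL-Library.Poly_Mapping" "HOL-Library.Extended_Nat"
begin

section \<open>Depth of a module with respect to an ideal\<close>

text \<open>
  \<open>seq_submodule R M [f\<^sub>1, \<dots>, f\<^sub>r]\<close> is the submodule \<open>(f\<^sub>1, \<dots>, f\<^sub>r)M = f\<^sub>1M + \<dots> + f\<^sub>rM\<close> of \<open>M\<close>.
\<close>

definition seq_submodule ::
    "('a, 'r) ring_scheme \<Rightarrow> ('a, 'b, 'm) module_scheme \<Rightarrow> 'a list \<Rightarrow> 'b set" where
  "seq_submodule R M fs =
     {finsum M (\<lambda>i. (fs ! i) \<odot>\<^bsub>M\<^esub> u i) {..<length fs} | u. u \<in> {..<length fs} \<rightarrow> carrier M}"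

text \<open>
  \<open>[f\<^sub>1, \<dots>, f\<^sub>r]\<close> is \<open>M\<close>-regular iff every \<open>f\<^sub>i\<close> is a nonzerodivisor on
  \<open>M/(f\<^sub>1, \<dots>, f\<^bsub>i-1\<^esub>)M\<close> and \<open>M \<noteq> (f\<^sub>1, \<dots>, f\<^sub>r)M\<close>.  Being a nonzerodivisor on a quotient
  module \<open>M/N\<close> is written out on representatives: \<open>f u \<in> N\<close> implies \<open>u \<in> N\<close>.
\<close>

definition regular_sequence ::
    "('a, 'r) ring_scheme \<Rightarrow> ('a, 'b, 'm) module_scheme \<Rightarrow> 'a list \<Rightarrow> bool" where
  "regular_sequence R M fs \<longleftrightarrow>
     set fs \<subseteq> carrier R \<and>
     (\<forall>i<length fs. \<forall>u\<in>carrier M.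
        (fs ! i) \<odot>\<^bsub>M\<^esub> u \<in> seq_submodule R M (take i fs) \<longrightarrow> u \<in> seq_submodule R M (take i fs)) \<and>
     seq_submodule R M fs \<noteq> carrier M"

text \<open>
  The supremum is taken in \<^typ>\<open>enat\<close>, so that it is a genuine one without any
  boundedness assumption.  For \<open>M = 0\<close> it is \<open>0\<close>, whereas the usual convention is \<open>\<infinity>\<close>.
\<close>

definition depth ::
    "('a, 'r) ring_scheme \<Rightarrow> 'a set \<Rightarrow> ('a, 'b, 'm) module_scheme \<Rightarrow> enat" where
  "depth R \<mm> M = (SUP fs \<in> {fs. set fs \<subseteq> \<mm> \<and> regular_sequence R M fs}. enat (length fs))"

text \<open>
  The record type of modules extends that of rings, so \<open>mult\<close> and \<open>one\<close> have to be filled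
  in; they play no role in the module structure.
\<close>

definition quotient_module :: "('a, 'r) ring_scheme \<Rightarrow> 'a set \<Rightarrow> ('a, 'a set) module" where
  "quotient_module R I =
     \<lparr>carrier = carrier (R Quot I), mult = mult (R Quot I), one = one (R Quot I),
      zero = zero (R Quot I), add = add (R Quot I),
      smult = (\<lambda>a Y. (I +>\<^bsub>R\<^esub> a) \<otimes>\<^bsub>R Quot I\<^esub> Y)\<rparr>"

lemma quotient_module_is_module:
  assumes "cring R" "ideal I R"
  shows "Module.module R (quotient_module R I)"
proof -
  interpret R: cring R by fact
  interpret ideal I R by fact
  interpret Q: cring "R Quot I" using quotient_is_cring assms(1) .
  interpret h: ring_hom_ring R "R Quot I" "(+>\<^bsub>R\<^esub>) I" by (rule rcos_ring_hom_ring)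
  have simps:
    "carrier (quotient_module R I) = carrier (R Quot I)"
    "add (quotient_module R I) = add (R Quot I)"
    "zero (quotient_module R I) = zero (R Quot I)"
    "smult (quotient_module R I) a Y = (I +>\<^bsub>R\<^esub> a) \<otimes>\<^bsub>R Quot I\<^esub> Y" for a Y
    by (simp_all add: quotient_module_def)
  have "abelian_group (quotient_module R I)"
  proof (rule abelian_groupI)
    fix x assume "x \<in> carrier (quotient_module R I)"
    then show "\<exists>y\<in>carrier (quotient_module R I).
        y \<oplus>\<^bsub>quotient_module R I\<^esub> x = \<zero>\<^bsub>quotient_module R I\<^esub>"
      by (auto simp: simps intro!: bexI[of _ "\<ominus>\<^bsub>R Quot I\<^esub> x"] Q.l_neg)
  qed (simp_all add: simps Q.a_ac)
  then show ?thesis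
    by (intro moduleI assms)
       (simp_all add: simps Q.l_distr Q.r_distr Q.m_assoc)
qed


section \<open>The polynomial ring in the variables \<open>x\<^sub>1, \<dots>, x\<^sub>n\<close>\<close>

text \<open>
  A monomial is its finitely supported exponent function on variable indices, and a
  polynomial is a finitely supported function from monomials to coefficients, with
  the convolution product of \<^theory>\<open>HOL-Library.Poly_Mapping\<close>.
\<close>

type_synonym 'k mpoly = "(nat \<Rightarrow>\<^sub>0 nat) \<Rightarrow>\<^sub>0 'k"

definition mvar :: "nat \<Rightarrow> 'k::field mpoly" where
  "mvar i = Poly_Mapping.single (Poly_Mapping.single i 1) 1"

definition mpoly_ring :: "nat \<Rightarrow> 'k::field mpoly ring" where
  "mpoly_ring n =
     \<lparr>carrier = {p. \<forall>m \<in> Poly_Mapping.keys p. Poly_Mapping.keys m \<subseteq> {1..n}},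
      mult = (*), one = 1, zero = 0, add = (+)\<rparr>"

definition graded_maximal_ideal :: "nat \<Rightarrow> 'k::field mpoly set" where
  "graded_maximal_ideal n = Idl\<^bsub>mpoly_ring n\<^esub> (mvar ` {1..n})"

lemma mpoly_ring_is_cring: "cring (mpoly_ring n :: 'k::field mpoly ring)"
proof -
  let ?S = "mpoly_ring n :: 'k mpoly ring"
  have C: "p \<in> carrier ?S \<longleftrightarrow> (\<forall>m \<in> Poly_Mapping.keys p. Poly_Mapping.keys m \<subseteq> {1..n})" for p
    by (simp add: mpoly_ring_def)
  have ops: "p \<oplus>\<^bsub>?S\<^esub> q = p + q" "p \<otimes>\<^bsub>?S\<^esub> q = p * q" "\<zero>\<^bsub>?S\<^esub> = 0" "\<one>\<^bsub>?S\<^esub> = 1" for p q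
    by (simp_all add: mpoly_ring_def)
  have add: "p + q \<in> carrier ?S" if "p \<in> carrier ?S" "q \<in> carrier ?S" for p q
    using that Poly_Mapping.keys_add[of p q] unfolding C by blast
  have mult: "p * q \<in> carrier ?S" if pq: "p \<in> carrier ?S" "q \<in> carrier ?S" for p q
    unfolding C
  proof
    fix m assume "m \<in> Poly_Mapping.keys (p * q)"
    then obtain a b where "m = a + b" "a \<in> Poly_Mapping.keys p" "b \<in> Poly_Mapping.keys q"
      using keys_mult[of p q] by blast
    then show "Poly_Mapping.keys m \<subseteq> {1..n}"
      using pq[unfolded C] Poly_Mapping.keys_add[of a b] by blast
  qed
  have neg: "- p \<in> carrier ?S" if "p \<in> carrier ?S" for p
    using that by (simp add: C)
  have zero: "0 \<in> carrier ?S" and one: "1 \<in> carrier ?S"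
    by (simp_all add: C)
  show ?thesis
  proof (rule cringI)
    show "abelian_group ?S"
    proof (rule abelian_groupI)
      fix p assume "p \<in> carrier ?S"
      then show "\<exists>q\<in>carrier ?S. q \<oplus>\<^bsub>?S\<^esub> p = \<zero>\<^bsub>?S\<^esub>"
        using neg by (intro bexI[of _ "- p"]) (simp_all add: ops)
    qed (simp_all add: ops add zero add.assoc add.commute)
    show "Group.comm_monoid ?S"
      by (rule comm_monoidI) (simp_all add: ops mult one mult.assoc mult.commute)
  qed (simp add: ops distrib_right)
qed


section \<open>The 3-path ideal of the square of a path\<close>

text \<open>
  A simple graph on the vertex set \<open>{1..n}\<close> is given by its set of edges, which are
  two-element subsets of \<open>{1..n}\<close>.
\<close>

definition path_square_edges :: "nat \<Rightarrow> nat set set" where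
  "path_square_edges n = {{i, j} | i j. 1 \<le> i \<and> i < j \<and> j \<le> n \<and> 0 < j - i \<and> j - i \<le> 2}"

definition path3_ideal :: "nat \<Rightarrow> nat set set \<Rightarrow> 'k::field mpoly set" where
  "path3_ideal n E =
     Idl\<^bsub>mpoly_ring n\<^esub> {mvar a * mvar b * mvar c | a b c.
       a \<in> {1..n} \<and> b \<in> {1..n} \<and> c \<in> {1..n} \<and> distinct [a, b, c] \<and> {a, b} \<in> E \<and> {b, c} \<in> E}"

lemma mvar_in_mpoly_ring: "i \<in> {1..n} \<Longrightarrow> mvar i \<in> carrier (mpoly_ring n)"
  by (simp add: mvar_def mpoly_ring_def)

lemma path3_ideal_is_ideal: "ideal (path3_ideal n E :: 'k::field mpoly set) (mpoly_ring n)"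
proof -
  interpret cring "mpoly_ring n :: 'k mpoly ring" by (rule mpoly_ring_is_cring)
  have "mvar a * mvar b * mvar c \<in> carrier (mpoly_ring n :: 'k mpoly ring)"
    if "a \<in> {1..n}" "b \<in> {1..n}" "c \<in> {1..n}" for a b c
  proof -
    have "mvar a \<otimes>\<^bsub>mpoly_ring n\<^esub> mvar b \<otimes>\<^bsub>mpoly_ring n\<^esub> mvar c \<in> carrier (mpoly_ring n :: 'k mpoly ring)"
      using that by (intro m_closed mvar_in_mpoly_ring)
    then show ?thesis by (simp add: mpoly_ring_def)
  qed
  then show ?thesis
    unfolding path3_ideal_def by (intro genideal_ideal) auto
qed

lemma path_square_edges_iff:
  "{a, b} \<in> path_square_edges n \<longleftrightarrow>
     a \<in> {1..n} \<and> b \<in> {1..n} \<and> (b = a + 1 \<or> b = a + 2 \<or> a = b + 1 \<or> a = b + 2)"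
proof
  assume "{a, b} \<in> path_square_edges n"
  then show "a \<in> {1..n} \<and> b \<in> {1..n} \<and> (b = a + 1 \<or> b = a + 2 \<or> a = b + 1 \<or> a = b + 2)"
    by (auto simp: path_square_edges_def doubleton_eq_iff)
next
  assume *: "a \<in> {1..n} \<and> b \<in> {1..n} \<and> (b = a + 1 \<or> b = a + 2 \<or> a = b + 1 \<or> a = b + 2)"
  show "{a, b} \<in> path_square_edges n"
  proof (cases "a < b")
    case True
    with * show ?thesis
      unfolding path_square_edges_def mem_Collect_eq
      by (intro exI[of _ a] exI[of _ b]) auto
  next
    case False
    with * show ?thesis
      unfolding path_square_edges_def mem_Collect_eq
      by (intro exI[of _ b] exI[of _ a]) auto
  qed
qed

lemma path3_ideal_path_square:
  "path3_ideal n (path_square_edges n) =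
     Idl\<^bsub>mpoly_ring n\<^esub>
       ({mvar i * mvar (i + 1) * mvar (i + 2) | i. 1 \<le> i \<and> i + 2 \<le> n} \<union>
        {mvar i * mvar (i + 1) * mvar (i + 3) | i. 1 \<le> i \<and> i + 3 \<le> n} \<union>
        {mvar i * mvar (i + 2) * mvar (i + 3) | i. 1 \<le> i \<and> i + 3 \<le> n} \<union>
        {mvar i * mvar (i + 2) * mvar (i + 4) | i. 1 \<le> i \<and> i + 4 \<le> n})"
  (is "_ = Idl\<^bsub>_\<^esub> ?G")
proof -
  let ?v = "mvar :: nat \<Rightarrow> 'a mpoly"
  let ?P = "{?v a * ?v b * ?v c | a b c.
     a \<in> {1..n} \<and> b \<in> {1..n} \<and> c \<in> {1..n} \<and> distinct [a, b, c] \<and>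
     {a, b} \<in> path_square_edges n \<and> {b, c} \<in> path_square_edges n}"
  have P: "?v a * ?v b * ?v c \<in> ?P"
    if "{a, b} \<in> path_square_edges n" "{b, c} \<in> path_square_edges n" "distinct [a, b, c]" for a b c
    using that unfolding path_square_edges_iff by blast
  have "?P = ?G"
  proof (intro equalityI subsetI)
    fix p assume "p \<in> ?P"
    then obtain a b c where p: "p = ?v a * ?v b * ?v c"
      and abc: "a \<in> {1..n}" "b \<in> {1..n}" "c \<in> {1..n}" "distinct [a, b, c]"
      and ab: "b = a + 1 \<or> b = a + 2 \<or> a = b + 1 \<or> a = b + 2"
      and bc: "c = b + 1 \<or> c = b + 2 \<or> b = c + 1 \<or> b = c + 2"
      unfolding path_square_edges_iff by blast
    have G1: "?v i * ?v j * ?v k \<in> ?G" if "1 \<le> i" "k \<le> n" "j = i + 1" "k = i + 2" for i j k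
      using that by blast
    have G2: "?v i * ?v j * ?v k \<in> ?G" if "1 \<le> i" "k \<le> n" "j = i + 1" "k = i + 3" for i j k
      using that by blast
    have G3: "?v i * ?v j * ?v k \<in> ?G" if "1 \<le> i" "k \<le> n" "j = i + 2" "k = i + 3" for i j k
      using that by blast
    have G4: "?v i * ?v j * ?v k \<in> ?G" if "1 \<le> i" "k \<le> n" "j = i + 2" "k = i + 4" for i j k
      using that by blast
    have perms: "p = ?v a * ?v c * ?v b" "p = ?v b * ?v a * ?v c" "p = ?v b * ?v c * ?v a"
      "p = ?v c * ?v a * ?v b" "p = ?v c * ?v b * ?v a"
      unfolding p by (simp_all only: mult_ac)
    have ac: "a \<noteq> c" using abc(4) by simp
    have "(b = a + 1 \<and> c = a + 2) \<or> (b = a + 1 \<and> c = a + 3) \<or> (b = a + 2 \<and> c = a + 3)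
        \<or> (b = a + 2 \<and> c = a + 4)
        \<or> (b = c + 1 \<and> a = c + 2) \<or> (b = c + 1 \<and> a = c + 3) \<or> (b = c + 2 \<and> a = c + 3)
        \<or> (b = c + 2 \<and> a = c + 4)
        \<or> (a = b + 1 \<and> c = b + 2) \<or> (c = b + 1 \<and> a = b + 2)
        \<or> (a + 1 = b \<and> c + 2 = b) \<or> (c + 1 = b \<and> a + 2 = b)"
      using ab bc ac by (elim disjE) simp_all
    then show "p \<in> ?G"
    proof (elim disjE conjE, goal_cases)
      case 1 show ?thesis unfolding p by (rule G1) (use 1 abc in auto)
    next
      case 2 show ?thesis unfolding p by (rule G2) (use 2 abc in auto)
    next
      case 3 show ?thesis unfolding p by (rule G3) (use 3 abc in auto)
    next
      case 4 show ?thesis unfolding p by (rule G4) (use 4 abc in auto)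
    next
      case 5 show ?thesis unfolding perms(5) by (rule G1) (use 5 abc in auto)
    next
      case 6 show ?thesis unfolding perms(5) by (rule G2) (use 6 abc in auto)
    next
      case 7 show ?thesis unfolding perms(5) by (rule G3) (use 7 abc in auto)
    next
      case 8 show ?thesis unfolding perms(5) by (rule G4) (use 8 abc in auto)
    next
      case 9 show ?thesis unfolding perms(2) by (rule G1) (use 9 abc in auto)
    next
      case 10 show ?thesis unfolding perms(3) by (rule G1) (use 10 abc in auto)
    next
      case 11 show ?thesis unfolding perms(4) by (rule G1) (use 11 abc in auto)
    next
      case 12 show ?thesis unfolding perms(1) by (rule G1) (use 12 abc in auto)
    qed
  next
    fix p assume "p \<in> ?G"
    then consider i where "p = ?v i * ?v (i + 1) * ?v (i + 2)" "1 \<le> i" "i + 2 \<le> n"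
      | i where "p = ?v i * ?v (i + 1) * ?v (i + 3)" "1 \<le> i" "i + 3 \<le> n"
      | i where "p = ?v i * ?v (i + 2) * ?v (i + 3)" "1 \<le> i" "i + 3 \<le> n"
      | i where "p = ?v i * ?v (i + 2) * ?v (i + 4)" "1 \<le> i" "i + 4 \<le> n"
      by blast
    then show "p \<in> ?P"
    proof cases
      case 1 show ?thesis unfolding 1(1) by (rule P) (use 1 in \<open>simp_all add: path_square_edges_iff\<close>)
    next
      case 2 show ?thesis unfolding 2(1) by (rule P) (use 2 in \<open>simp_all add: path_square_edges_iff\<close>)
    next
      case 3 show ?thesis unfolding 3(1) by (rule P) (use 3 in \<open>simp_all add: path_square_edges_iff\<close>)
    next
      case 4 show ?thesis unfolding 4(1) by (rule P) (use 4 in \<open>simp_all add: path_square_edges_iff\<close>)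
    qed
  qed
  then show ?thesis by (simp only: path3_ideal_def)
qed

end

theory Submission
  imports Defs
begin

text \<open>
  The ideal is the Stanley--Reisner ideal of the complex of all vertex sets that contain no 3-path,
  and its depth turns out to be the least size of a facet.

  Upper bound. Let \<open>F\<close> be a facet with \<open>d\<close> elements and \<open>w\<close> its monomial. The annihilator of \<open>w\<close> in the
  quotient is generated by the variables outside \<open>F\<close>, so \<open>w\<close> spans a copy of a polynomial ring in \<open>d\<close>
  variables. High powers of the members of a regular sequence again form a regular sequence and
  do not generate \<open>w\<close>; this makes the multiples of \<open>w\<close> by products of these powers linearly
  independent, and a dimension count bounds the length of the sequence by \<open>d\<close>. The edges \<open>{7i+3, 7i+5}\<close> dominate the
  graph and give a small facet.

  Lower bound. The elementary symmetric polynomials \<open>e\<^sub>t, \<dots>, e\<^sub>1\<close> restrict to a regular sequence on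
  every polynomial ring in at least \<open>t\<close> of the variables, over any field, finite ones included.
  Repeatedly replacing \<open>I\<close> by \<open>I : x\<^sub>v\<close> and \<open>I + (x\<^sub>v)\<close>, with the vertices chosen in a suitable order,
  reduces the quotient to such polynomial rings, and regularity of a sequence passes from the two
  outer terms of a short exact sequence to the middle one.
\<close>

section \<open>Weakly regular sequences modulo an ideal\<close>

definition is_ideal :: "'a::comm_ring_1 set \<Rightarrow> bool" where
  "is_ideal J \<longleftrightarrow> 0 \<in> J \<and> (\<forall>a\<in>J. \<forall>b\<in>J. a + b \<in> J) \<and> (\<forall>a\<in>J. \<forall>r. r * a \<in> J)"

text \<open>For an ideal \<open>J\<close> this is the ideal \<open>J + (f)\<close>. Ideals are kept
  as plain sets of representatives, so that no quotient ring has to be formed.\<close>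

definition adjoin :: "'a::comm_ring_1 set \<Rightarrow> 'a \<Rightarrow> 'a set" where
  "adjoin J f = {p. \<exists>s. p - f * s \<in> J}"

definition colon :: "'a::comm_ring_1 set \<Rightarrow> 'a \<Rightarrow> 'a set" where
  "colon J x = {p. x * p \<in> J}"

definition nonzerodivisor_mod :: "'a::comm_ring_1 set \<Rightarrow> 'a \<Rightarrow> bool" where
  "nonzerodivisor_mod J f \<longleftrightarrow> (\<forall>u. f * u \<in> J \<longrightarrow> u \<in> J)"

lemma nonzerodivisor_modD: "nonzerodivisor_mod J f \<Longrightarrow> f * u \<in> J \<Longrightarrow> u \<in> J"
  by (simp add: nonzerodivisor_mod_def)

text \<open>Weak, because the successive quotients may vanish: modulo the unit ideal every list
  qualifies. Void complexes can thus be leaves of a splitting tree. Properness is tested once, at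
  the end, as \<open>1 \<notin> foldl adjoin J fs\<close>.\<close>

fun weakly_regular :: "'a::comm_ring_1 set \<Rightarrow> 'a list \<Rightarrow> bool" where
  "weakly_regular J [] \<longleftrightarrow> True"
| "weakly_regular J (f # fs) \<longleftrightarrow> nonzerodivisor_mod J f \<and> weakly_regular (adjoin J f) fs"

lemma ideal_zero: "is_ideal J \<Longrightarrow> 0 \<in> J"
  and ideal_add: "is_ideal J \<Longrightarrow> a \<in> J \<Longrightarrow> b \<in> J \<Longrightarrow> a + b \<in> J"
  and ideal_mult: "is_ideal J \<Longrightarrow> a \<in> J \<Longrightarrow> r * a \<in> J"
  and ideal_mult2: "is_ideal J \<Longrightarrow> a \<in> J \<Longrightarrow> a * r \<in> J"
  by (auto simp: is_ideal_def mult.commute)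

lemma ideal_diff: "is_ideal J \<Longrightarrow> a \<in> J \<Longrightarrow> b \<in> J \<Longrightarrow> a - b \<in> J"
  using ideal_add[of J a "(- 1) * b"] ideal_mult[of J b "- 1"] by simp

lemma ideal_add_iff: "is_ideal J \<Longrightarrow> a \<in> J \<Longrightarrow> a + b \<in> J \<longleftrightarrow> b \<in> J"
  using ideal_add[of J a b] ideal_diff[of J "a + b" a] by auto

lemma ideal_sum: "is_ideal J \<Longrightarrow> (\<And>x. x \<in> A \<Longrightarrow> g x \<in> J) \<Longrightarrow> sum g A \<in> J"
  by (induction A rule: infinite_finite_induct) (auto intro: ideal_zero ideal_add)

lemma ideal_adjoin: assumes "is_ideal J" shows "is_ideal (adjoin J f)"
  unfolding is_ideal_def
proof (intro conjI ballI allI)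
  show "0 \<in> adjoin J f" using assms ideal_zero by (auto simp: adjoin_def intro!: exI[of _ 0])
next
  fix a b assume "a \<in> adjoin J f" "b \<in> adjoin J f"
  then obtain s t where "a - f * s \<in> J" "b - f * t \<in> J" by (auto simp: adjoin_def)
  from ideal_add[OF assms this] have "a + b - f * (s + t) \<in> J" by (simp add: algebra_simps)
  then show "a + b \<in> adjoin J f" unfolding adjoin_def by blast
next
  fix a r assume "a \<in> adjoin J f"
  then obtain s where "a - f * s \<in> J" by (auto simp: adjoin_def)
  from ideal_mult[OF assms this, of r] have "r * a - f * (r * s) \<in> J" by (simp add: algebra_simps)
  then show "r * a \<in> adjoin J f" unfolding adjoin_def by blast
qed

lemma ideal_subset_adjoin: "J \<subseteq> adjoin J f"
  by (auto simp: adjoin_def intro!: exI[of _ 0])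

lemma mult_in_adjoin: "is_ideal J \<Longrightarrow> f * s \<in> adjoin J f"
  by (auto simp: adjoin_def ideal_zero intro!: exI[of _ s])

lemma adjoin_commute: "adjoin (adjoin J f) g = adjoin (adjoin J g) f"
proof -
  have "adjoin (adjoin J f) g \<subseteq> adjoin (adjoin J g) f" for f g
  proof
    fix p assume "p \<in> adjoin (adjoin J f) g"
    then obtain s t where "p - g * s - f * t \<in> J" by (auto simp: adjoin_def)
    then have "p - f * t - g * s \<in> J" by (simp add: algebra_simps)
    then show "p \<in> adjoin (adjoin J g) f" unfolding adjoin_def by blast
  qed
  then show ?thesis by blast
qed

lemma adjoin_cong:
  assumes "is_ideal J" "f - g \<in> J"
  shows "adjoin J f = adjoin J g"
proof -
  have "p - f * s \<in> J \<longleftrightarrow> p - g * s \<in> J" for p s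
    using ideal_add_iff[OF assms(1) ideal_mult[OF assms, of s], of "p - f * s"]
    by (simp add: algebra_simps)
  then show ?thesis by (simp add: adjoin_def)
qed

lemma nonzerodivisor_mod_cong:
  assumes "is_ideal J" "f - g \<in> J" "nonzerodivisor_mod J g"
  shows "nonzerodivisor_mod J f"
  unfolding nonzerodivisor_mod_def
proof (intro allI impI)
  fix u assume "f * u \<in> J"
  then have "f * u - (f - g) * u \<in> J" 
    by (rule ideal_diff[OF assms(1) _ ideal_mult2[OF assms(1,2)]])
  then have "g * u \<in> J" by (simp add: algebra_simps)
  then show "u \<in> J" using assms(3) by (simp add: nonzerodivisor_mod_def)
qed

lemma adjoin_UNIV: "adjoin UNIV f = UNIV"
  by (auto simp: adjoin_def)

lemma weakly_regular_UNIV: "weakly_regular UNIV fs"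
  by (induction fs) (simp_all add: nonzerodivisor_mod_def adjoin_UNIV)

text \<open>If \<open>f\<close> kills \<open>u\<close> modulo \<open>J\<close>, then
  \<open>u\<close> is a multiple \<open>x * s\<close> modulo \<open>J\<close> by the hypothesis on
  \<open>adjoin J x\<close>, and \<open>f\<close> kills \<open>s\<close> modulo
  \<open>colon J x\<close>.\<close>

lemma nonzerodivisor_mod_colonI:
  assumes J: "is_ideal J" and "nonzerodivisor_mod (colon J x) f" "nonzerodivisor_mod (adjoin J x) f"
  shows "nonzerodivisor_mod J f"
  unfolding nonzerodivisor_mod_def
proof (intro allI impI)
  fix u assume fu: "f * u \<in> J"
  then have "u \<in> adjoin J x"
    using nonzerodivisor_modD[OF assms(3)] ideal_subset_adjoin by blast
  then obtain s where s: "u - x * s \<in> J" by (auto simp: adjoin_def)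
  have "x * (f * s) = f * u - f * (u - x * s)" by (simp add: algebra_simps)
  also have "\<dots> \<in> J" by (intro ideal_diff[OF J] fu ideal_mult[OF J] s)
  finally have "f * s \<in> colon J x" by (simp add: colon_def)
  then have "s \<in> colon J x" by (rule nonzerodivisor_modD[OF assms(2)])
  then have "x * s \<in> J" by (simp add: colon_def)
  from ideal_add[OF J s this] show "u \<in> J" by simp
qed

text \<open>A case of the snake lemma: since \<open>f\<close> is injective modulo
  \<open>adjoin J x\<close>, the sequence relating \<open>colon J x\<close>, \<open>J\<close> and
  \<open>adjoin J x\<close> stays exact after reduction modulo \<open>f\<close>.\<close>

lemma colon_adjoin:
  assumes J: "is_ideal J" and "nonzerodivisor_mod (adjoin J x) f"
  shows "colon (adjoin J f) x = adjoin (colon J x) f"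
proof
  show "colon (adjoin J f) x \<subseteq> adjoin (colon J x) f"
  proof
    fix u assume "u \<in> colon (adjoin J f) x"
    then obtain s where s: "x * u - f * s \<in> J" by (auto simp: adjoin_def colon_def)
    have "f * s - x * u \<in> J" using ideal_diff[OF J ideal_zero[OF J] s] by simp
    then have "f * s \<in> adjoin J x" unfolding adjoin_def by blast
    then have "s \<in> adjoin J x" by (rule nonzerodivisor_modD[OF assms(2)])
    then obtain t where t: "s - x * t \<in> J" by (auto simp: adjoin_def)
    have "x * (u - f * t) = (x * u - f * s) + f * (s - x * t)" by (simp add: algebra_simps)
    also have "\<dots> \<in> J" by (intro ideal_add[OF J] s ideal_mult[OF J] t)
    finally show "u \<in> adjoin (colon J x) f" by (auto simp: adjoin_def colon_def)
  qed
next
  show "adjoin (colon J x) f \<subseteq> colon (adjoin J f) x"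
  proof
    fix u assume "u \<in> adjoin (colon J x) f"
    then obtain s where "x * (u - f * s) \<in> J" by (auto simp: adjoin_def colon_def)
    then have "x * u - f * (x * s) \<in> J" by (simp add: algebra_simps)
    then show "u \<in> colon (adjoin J f) x" unfolding colon_def adjoin_def by blast
  qed
qed

text \<open>Regularity passes to the middle term of
  \<open>0 \<rightarrow> R/(J : x) \<rightarrow> R/J \<rightarrow> R/(J + xR) \<rightarrow> 0\<close>, the first map being multiplication by \<open>x\<close>.\<close>

lemma weakly_regular_colonI:
  assumes "is_ideal J" "weakly_regular (colon J x) fs" "weakly_regular (adjoin J x) fs"
  shows "weakly_regular J fs"
  using assms
proof (induction fs arbitrary: J)
  case (Cons f fs)
  have "weakly_regular (colon (adjoin J f) x) fs" "weakly_regular (adjoin (adjoin J f) x) fs"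
    using Cons.prems by (simp_all add: colon_adjoin adjoin_commute[of J f])
  then show ?case
    using Cons.IH[OF ideal_adjoin[OF Cons.prems(1)]] Cons.prems nonzerodivisor_mod_colonI by auto
qed simp

section \<open>Powers of the members of a weakly regular sequence\<close>

lemma nonzerodivisor_mod_power:
  assumes "nonzerodivisor_mod J f"
  shows "nonzerodivisor_mod J (f ^ k)"
proof (induction k)
  case (Suc k)
  show ?case
    unfolding nonzerodivisor_mod_def
  proof (intro allI impI)
    fix u assume "f ^ Suc k * u \<in> J"
    then have "f * (f ^ k * u) \<in> J" by (simp add: mult.assoc)
    then have "f ^ k * u \<in> J" using assms unfolding nonzerodivisor_mod_def by blast
    then show "u \<in> J" using Suc unfolding nonzerodivisor_mod_def by blast
  qed
qed (simp add: nonzerodivisor_mod_def)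

text \<open>For the ideal \<open>J + (f ^ Suc k)\<close> and \<open>x = f\<close>, the two outer
  ideals of the exact sequence are \<open>J + (f ^ k)\<close> and \<open>J + (f)\<close>. The
  induction starts at \<open>k = 0\<close> with the unit ideal.\<close>

lemma weakly_regular_adjoin_power:
  assumes J: "is_ideal J" and f: "nonzerodivisor_mod J f" and "weakly_regular (adjoin J f) fs"
  shows "weakly_regular (adjoin J (f ^ k)) fs"
proof (induction k)
  case 0
  have "p - f ^ 0 * p \<in> J" for p by (simp add: ideal_zero[OF J])
  then have "adjoin J (f ^ 0) = UNIV" unfolding adjoin_def by blast
  then show ?case by (simp add: weakly_regular_UNIV)
next
  case (Suc k)
  have "colon (adjoin J (f ^ Suc k)) f = adjoin J (f ^ k)"
  proof -
    have "f * p - f ^ Suc k * s \<in> J \<longleftrightarrow> p - f ^ k * s \<in> J" for p s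
    proof -
      have "f * p - f ^ Suc k * s = f * (p - f ^ k * s)" by (simp add: algebra_simps)
      then show ?thesis using nonzerodivisor_modD[OF f] ideal_mult[OF J] by metis
    qed
    then show ?thesis by (simp add: colon_def adjoin_def)
  qed
  moreover have "adjoin (adjoin J (f ^ Suc k)) f = adjoin J f"
  proof
    show "adjoin (adjoin J (f ^ Suc k)) f \<subseteq> adjoin J f"
    proof
      fix p assume "p \<in> adjoin (adjoin J (f ^ Suc k)) f"
      then obtain s t where "p - f * s - f ^ Suc k * t \<in> J" by (auto simp: adjoin_def)
      then have "p - f * (s + f ^ k * t) \<in> J" by (simp add: algebra_simps)
      then show "p \<in> adjoin J f" unfolding adjoin_def by blast
    qed
  next
    show "adjoin J f \<subseteq> adjoin (adjoin J (f ^ Suc k)) f"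
      using ideal_subset_adjoin[of "adjoin J f"] adjoin_commute[of J f] by metis
  qed
  ultimately show ?case
    using weakly_regular_colonI[OF ideal_adjoin[OF J], of "f ^ Suc k" f fs] Suc assms(3) by simp
qed

lemma weakly_regular_powers:
  assumes "is_ideal J" "weakly_regular J fs"
  shows "weakly_regular J (map (\<lambda>f. f ^ k) fs)"
  using assms
proof (induction fs arbitrary: J)
  case (Cons f fs)
  then have "weakly_regular (adjoin J (f ^ k)) fs"
    using weakly_regular_adjoin_power by auto
  with Cons show ?case by (auto simp: nonzerodivisor_mod_power ideal_adjoin)
qed simp

text \<open>An \<open>f\<close>-adic comparison: modulo \<open>f\<close> only \<open>q 0\<close>
  survives, so it vanishes. Then one factor \<open>f\<close> is cancelled and the argument repeats
  with the shifted coefficients.\<close>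

lemma sum_powers_in_ideal:
  fixes q :: "nat \<Rightarrow> 'a::comm_ring_1"
  assumes J: "is_ideal J" and f: "nonzerodivisor_mod J f"
    and "(\<Sum>a<s. f ^ a * q a) \<in> J"
    and q: "\<And>a. a < s \<Longrightarrow> q a \<in> adjoin J f \<Longrightarrow> q a = 0"
  shows "\<forall>a<s. q a = 0"
  using assms(3,4)
proof (induction s arbitrary: q)
  case (Suc s)
  have eq: "(\<Sum>a<Suc s. f ^ a * q a) = q 0 + f * (\<Sum>a<s. f ^ a * q (Suc a))"
    by (simp add: sum.lessThan_Suc_shift sum_distrib_left mult.assoc del: sum.lessThan_Suc)
  have "q 0 - f * (- (\<Sum>a<s. f ^ a * q (Suc a))) \<in> J"
    using Suc.prems(1) unfolding eq by simp
  then have "q 0 \<in> adjoin J f" unfolding adjoin_def by blast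
  then have q0: "q 0 = 0" using Suc.prems(2) by simp
  have "f * (\<Sum>a<s. f ^ a * q (Suc a)) \<in> J" using Suc.prems(1) unfolding eq q0 by simp
  then have "(\<Sum>a<s. f ^ a * q (Suc a)) \<in> J" by (rule nonzerodivisor_modD[OF f])
  then have "\<forall>a<s. q (Suc a) = 0" using Suc.IH[of "\<lambda>a. q (Suc a)"] Suc.prems(2) by simp
  with q0 show ?case using less_Suc_eq_0_disj by metis
qed simp

definition exponent_lists :: "nat \<Rightarrow> nat \<Rightarrow> nat list set" where
  "exponent_lists s r = {as. set as \<subseteq> {..<s} \<and> length as = r}"

definition power_product :: "'a::comm_ring_1 list \<Rightarrow> nat list \<Rightarrow> 'a" where
  "power_product fs as = prod_list (map2 (^) fs as)"

lemma finite_exponent_lists: "finite (exponent_lists s r)"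
  and card_exponent_lists: "card (exponent_lists s r) = s ^ r"
  by (simp_all add: exponent_lists_def finite_lists_length_eq card_lists_length_eq)

lemma exponent_lists_0: "exponent_lists s 0 = {[]}"
  by (auto simp: exponent_lists_def)

lemma sum_exponent_lists_Suc:
  fixes g :: "nat list \<Rightarrow> 'b::comm_monoid_add"
  shows "sum g (exponent_lists s (Suc r)) = (\<Sum>a<s. \<Sum>as\<in>exponent_lists s r. g (a # as))"
proof -
  have "exponent_lists s (Suc r) = (\<lambda>(a, as). a # as) ` ({..<s} \<times> exponent_lists s r)"
    by (auto simp: exponent_lists_def length_Suc_conv image_iff)
  moreover have "inj_on (\<lambda>(a, as). a # as) ({..<s} \<times> exponent_lists s r)"
    by (auto simp: inj_on_def)
  ultimately have "sum g (exponent_lists s (Suc r)) = sum (g \<circ> (\<lambda>(a, as). a # as)) ({..<s} \<times> exponent_lists s r)"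
    by (simp add: sum.reindex)
  then show ?thesis by (simp add: sum.cartesian_product comp_def split_def)
qed

text \<open>Comparing lowest powers of \<open>f\<^sub>1\<close>, then of \<open>f\<^sub>2\<close>, and so on, shows that the lowest
  coefficient times \<open>w\<close> lies in \<open>J + (f\<^sub>1, \<dots>, f\<^sub>r)\<close>.\<close>

lemma weakly_regular_imp_independent:
  fixes c :: "nat list \<Rightarrow> 'a::comm_ring_1"
  assumes "is_ideal J" "weakly_regular J fs" "w \<notin> foldl adjoin J fs"
    and "\<And>as. c as = 0 \<or> c as dvd 1"
    and "(\<Sum>as\<in>exponent_lists s (length fs). c as * power_product fs as) * w \<in> J"
  shows "\<forall>as\<in>exponent_lists s (length fs). c as = 0"
  using assms
proof (induction fs arbitrary: J c)
  case Nil
  have "c [] = 0"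
  proof (rule ccontr)
    assume "c [] \<noteq> 0"
    then obtain d where "1 = c [] * d" using Nil.prems(4)[of "[]"] by (auto elim: dvdE)
    then have "d * (c [] * w) = w" by (metis mult.assoc mult.commute mult_1)
    moreover have "c [] * w \<in> J" using Nil.prems(5) by (simp add: exponent_lists_0 power_product_def)
    ultimately have "w \<in> J" using ideal_mult[OF Nil.prems(1)] by metis
    then show False using Nil.prems(3) by simp
  qed
  then show ?case by (simp add: exponent_lists_0)
next
  case (Cons f fs)
  let ?r = "length fs"
  define q where "q a = (\<Sum>as\<in>exponent_lists s ?r. c (a # as) * power_product fs as) * w" for a
  have J: "is_ideal J" and f: "nonzerodivisor_mod J f" and fs: "weakly_regular (adjoin J f) fs"
    using Cons.prems by auto
  \<comment> \<open>The induction hypothesis modulo \<open>adjoin J f\<close> kills all coefficients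
    in \<open>q a\<close>, so \<open>q a\<close> is not merely in that ideal but literally zero, as
    \<open>sum_powers_in_ideal\<close> demands.\<close>
  have step: "\<forall>as\<in>exponent_lists s ?r. c (a # as) = 0" if "q a \<in> adjoin J f" for a
    using Cons.IH[OF ideal_adjoin[OF J] fs, of "\<lambda>as. c (a # as)"] Cons.prems(3,4) that
    by (simp add: q_def)
  have "(\<Sum>as\<in>exponent_lists s (length (f # fs)). c as * power_product (f # fs) as) * w
      = (\<Sum>a<s. f ^ a * q a)"
    by (simp add: sum_exponent_lists_Suc q_def power_product_def sum_distrib_left sum_distrib_right mult_ac)
  then have "(\<Sum>a<s. f ^ a * q a) \<in> J" using Cons.prems(5) by simp
  moreover have "q a = 0" if "q a \<in> adjoin J f" for a
    using step[OF that] by (simp add: q_def)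
  ultimately have "\<forall>a<s. q a = 0" using sum_powers_in_ideal[OF J f, of q s] by blast
  then have "\<forall>a<s. \<forall>as\<in>exponent_lists s ?r. c (a # as) = 0"
    using step ideal_zero[OF ideal_adjoin[OF J]] by metis
  then show ?case by (auto simp: exponent_lists_def length_Suc_conv)
qed

section \<open>Squarefree monomial ideals\<close>

lemma keys_nat_add: "Poly_Mapping.keys (a + b) = Poly_Mapping.keys a \<union> Poly_Mapping.keys (b :: 'a \<Rightarrow>\<^sub>0 nat)"
  by (auto simp: in_keys_iff lookup_add)

lemma lookup_single_mult_add:
  fixes p :: "'a::cancel_comm_monoid_add \<Rightarrow>\<^sub>0 'b::semiring_1"
  shows "Poly_Mapping.lookup (Poly_Mapping.single a c * p) (a + m) = c * Poly_Mapping.lookup p m"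
  by (simp add: lookup_mult lookup_single when_mult)

lemma keys_single_one_mult:
  fixes p :: "'a::cancel_comm_monoid_add \<Rightarrow>\<^sub>0 'b::semiring_1"
  shows "Poly_Mapping.keys (Poly_Mapping.single a 1 * p) = (+) a ` Poly_Mapping.keys p"
proof
  show "Poly_Mapping.keys (Poly_Mapping.single a 1 * p) \<subseteq> (+) a ` Poly_Mapping.keys p"
    using keys_mult[of "Poly_Mapping.single a (1::'b)" p] by auto
  show "(+) a ` Poly_Mapping.keys p \<subseteq> Poly_Mapping.keys (Poly_Mapping.single a 1 * p)"
    by (auto simp: in_keys_iff lookup_single_mult_add)
qed

text \<open>Serves to cut a polynomial down to its homogeneous parts, to its terms divisible by a
  given monomial, and to its terms in finitely many variables.\<close>

definition restrict_keys :: "'a set \<Rightarrow> ('a \<Rightarrow>\<^sub>0 'b::zero) \<Rightarrow> ('a \<Rightarrow>\<^sub>0 'b)" where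
  "restrict_keys Q p = Abs_poly_mapping (\<lambda>m. if m \<in> Q then Poly_Mapping.lookup p m else 0)"

lemma lookup_restrict_keys:
  "Poly_Mapping.lookup (restrict_keys Q p) m = (if m \<in> Q then Poly_Mapping.lookup p m else 0)"
proof -
  have "{m. (if m \<in> Q then Poly_Mapping.lookup p m else 0) \<noteq> 0} \<subseteq> Poly_Mapping.keys p"
    by (auto simp: in_keys_iff)
  then have "finite {m. (if m \<in> Q then Poly_Mapping.lookup p m else 0) \<noteq> 0}"
    by (rule finite_subset) simp
  then show ?thesis by (simp add: restrict_keys_def)
qed

lemma keys_restrict_keys: "Poly_Mapping.keys (restrict_keys Q p) = Poly_Mapping.keys p \<inter> Q"
  by (auto simp: in_keys_iff lookup_restrict_keys split: if_splits)

lemma restrict_keys_add: "restrict_keys Q (p + q) = restrict_keys Q p + restrict_keys Q q"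
  by (rule poly_mapping_eqI) (simp add: lookup_restrict_keys lookup_add)

lemma restrict_keys_diff:
  "restrict_keys Q (p - q) = restrict_keys Q p - restrict_keys Q (q :: _ \<Rightarrow>\<^sub>0 _::ab_group_add)"
  by (rule poly_mapping_eqI) (simp add: lookup_restrict_keys lookup_minus)

lemma restrict_keys_id: "Poly_Mapping.keys p \<subseteq> Q \<Longrightarrow> restrict_keys Q p = p"
  by (rule poly_mapping_eqI) (auto simp: lookup_restrict_keys in_keys_iff)

lemma restrict_keys_zero: "Poly_Mapping.keys p \<inter> Q = {} \<Longrightarrow> restrict_keys Q p = 0"
  by (rule poly_mapping_eqI) (auto simp: lookup_restrict_keys in_keys_iff)

lemma keys_diff_restrict_keys:
  fixes p :: "_ \<Rightarrow>\<^sub>0 _::ab_group_add"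
  shows "Poly_Mapping.keys (p - restrict_keys Q p) = Poly_Mapping.keys p - Q"
  by (auto simp: in_keys_iff lookup_restrict_keys lookup_minus split: if_splits)

text \<open>The Stanley--Reisner ideal of \<open>D\<close> in the polynomial ring in all variables \<open>x\<^sub>i\<close>, \<open>i\<close> a natural
  number. It contains every variable that is not a vertex of \<open>D\<close>, so that the quotient is the same
  as for the polynomial ring in the vertices only.\<close>

definition sr_ideal :: "nat set set \<Rightarrow> 'k::field mpoly set" where
  "sr_ideal D = {p. \<forall>m\<in>Poly_Mapping.keys p. Poly_Mapping.keys m \<notin> D}"

definition indicator_exponent :: "nat set \<Rightarrow> (nat \<Rightarrow>\<^sub>0 nat)" where
  "indicator_exponent A = (\<Sum>i\<in>A. Poly_Mapping.single i 1)"

text \<open>The squarefree monomial with support \<open>A\<close>.\<close>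

definition vmon :: "nat set \<Rightarrow> 'k::field mpoly" where
  "vmon A = Poly_Mapping.single (indicator_exponent A) 1"

text \<open>A simplicial complex, with the void complex \<open>{}\<close> allowed;
  \<open>sr_ideal {}\<close> is the whole ring.\<close>

definition down_closed :: "'a set set \<Rightarrow> bool" where
  "down_closed D \<longleftrightarrow> (\<forall>G\<in>D. \<forall>H. H \<subseteq> G \<longrightarrow> H \<in> D)"

lemma lookup_indicator_exponent:
  "finite A \<Longrightarrow> Poly_Mapping.lookup (indicator_exponent A) i = (if i \<in> A then 1 else 0)"
  by (simp add: indicator_exponent_def lookup_sum lookup_single when_def)

lemma keys_indicator_exponent: "finite A \<Longrightarrow> Poly_Mapping.keys (indicator_exponent A) = A"
  by (auto simp: in_keys_iff lookup_indicator_exponent split: if_splits)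

lemma down_closedD: "down_closed D \<Longrightarrow> G \<in> D \<Longrightarrow> H \<subseteq> G \<Longrightarrow> H \<in> D"
  by (auto simp: down_closed_def)

lemma ideal_sr_ideal: assumes D: "down_closed D" shows "is_ideal (sr_ideal D)"
  unfolding is_ideal_def
proof (intro conjI ballI allI)
  show "0 \<in> sr_ideal D" by (simp add: sr_ideal_def)
next
  fix a b :: "'a mpoly" assume "a \<in> sr_ideal D" "b \<in> sr_ideal D"
  then show "a + b \<in> sr_ideal D"
    using Poly_Mapping.keys_add[of a b] by (auto simp: sr_ideal_def)
next
  fix a r :: "'a mpoly" assume a: "a \<in> sr_ideal D"
  show "r * a \<in> sr_ideal D"
    unfolding sr_ideal_def mem_Collect_eq
  proof
    fix m assume "m \<in> Poly_Mapping.keys (r * a)"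
    then obtain b c where "m = b + c" "c \<in> Poly_Mapping.keys a"
      using keys_mult[of r a] by blast
    then show "Poly_Mapping.keys m \<notin> D"
      using a down_closedD[OF D] by (fastforce simp: sr_ideal_def keys_nat_add)
  qed
qed

text \<open>Multiplication by \<open>vmon A\<close> enlarges the support of each monomial by
  \<open>A\<close>. For down-closed \<open>D\<close> the new complex is the star of
  \<open>A\<close>.\<close>

lemma colon_sr_ideal:
  assumes "finite A"
  shows "colon (sr_ideal D) (vmon A) = sr_ideal {G. A \<union> G \<in> D}"
  using assms
  by (auto simp: colon_def sr_ideal_def vmon_def keys_single_one_mult keys_nat_add keys_indicator_exponent)

text \<open>The cofactor brings in no new variable, so it stays in the polynomial ring in finitely
  many variables when the monomial does.\<close>

lemma vmon_dvd_single:
  assumes "finite A" "A \<subseteq> Poly_Mapping.keys m"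
  shows "\<exists>m'. Poly_Mapping.keys m' \<subseteq> Poly_Mapping.keys m
    \<and> Poly_Mapping.single m c = vmon A * Poly_Mapping.single m' c"
proof -
  let ?m = "m - indicator_exponent A"
  have "m = indicator_exponent A + ?m"
  proof (rule poly_mapping_eqI)
    fix i
    have "i \<in> A \<Longrightarrow> Poly_Mapping.lookup m i \<noteq> 0" using assms by (auto simp: in_keys_iff)
    then show "Poly_Mapping.lookup m i = Poly_Mapping.lookup (indicator_exponent A + ?m) i"
      by (auto simp: lookup_add lookup_minus lookup_indicator_exponent assms)
  qed
  moreover from this have "Poly_Mapping.keys ?m \<subseteq> Poly_Mapping.keys m"
    by (metis keys_nat_add Un_upper2)
  ultimately show ?thesis by (intro exI[of _ ?m]) (simp add: vmon_def mult_single)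
qed

lemma poly_mapping_sum_singles:
  "p = (\<Sum>m\<in>Poly_Mapping.keys p. Poly_Mapping.single m (Poly_Mapping.lookup p m))"
  by (rule poly_mapping_eqI) (auto simp: lookup_sum lookup_single when_def in_keys_iff)

text \<open>For the harder inclusion a polynomial is split into the terms divisible by
  \<open>vmon A\<close>, which are multiples of it, and the rest, which already lies in
  \<open>sr_ideal D\<close>. With \<open>A = {v}\<close> the new complex is the deletion of
  \<open>v\<close>; with \<open>D = Pow A\<close> it is the boundary of a simplex.\<close>

lemma adjoin_sr_ideal:
  assumes A: "finite A" and D: "down_closed D"
  shows "adjoin (sr_ideal D) (vmon A) = (sr_ideal {G \<in> D. \<not> A \<subseteq> G} :: 'k::field mpoly set)"
proof
  let ?E = "{G \<in> D. \<not> A \<subseteq> G}"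
  have E: "down_closed ?E" using D by (auto simp: down_closed_def)
  have x: "vmon A * s \<in> sr_ideal ?E" for s :: "'k mpoly"
    using A by (auto simp: sr_ideal_def vmon_def keys_single_one_mult keys_nat_add keys_indicator_exponent)
  show "adjoin (sr_ideal D) (vmon A) \<subseteq> (sr_ideal ?E :: 'k mpoly set)"
  proof
    fix p :: "'k mpoly" assume "p \<in> adjoin (sr_ideal D) (vmon A)"
    then obtain s where "p - vmon A * s \<in> sr_ideal D" by (auto simp: adjoin_def)
    then have "p - vmon A * s \<in> sr_ideal ?E" by (auto simp: sr_ideal_def)
    from ideal_add[OF ideal_sr_ideal[OF E] this x[of s]] show "p \<in> sr_ideal ?E" by simp
  qed
  show "(sr_ideal ?E :: 'k mpoly set) \<subseteq> adjoin (sr_ideal D) (vmon A)"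
  proof
    fix p :: "'k mpoly" assume p: "p \<in> sr_ideal ?E"
    have J: "is_ideal (adjoin (sr_ideal D) (vmon A :: 'k mpoly))"
      by (intro ideal_adjoin ideal_sr_ideal D)
    have multiple: "Poly_Mapping.single m c \<in> adjoin (sr_ideal D) (vmon A :: 'k mpoly)"
      if m: "A \<subseteq> Poly_Mapping.keys m" for m c
    proof -
      obtain m' where "Poly_Mapping.single m c = vmon A * Poly_Mapping.single m' c"
        using vmon_dvd_single[OF A m] by blast
      then show ?thesis using mult_in_adjoin[OF ideal_sr_ideal[OF D]] by metis
    qed
    let ?Q = "{m. A \<subseteq> Poly_Mapping.keys m}"
    have "restrict_keys ?Q p = (\<Sum>m\<in>Poly_Mapping.keys (restrict_keys ?Q p).
        Poly_Mapping.single m (Poly_Mapping.lookup (restrict_keys ?Q p) m))"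
      by (rule poly_mapping_sum_singles)
    also have "\<dots> \<in> adjoin (sr_ideal D) (vmon A)"
      by (rule ideal_sum[OF J]) (auto simp: keys_restrict_keys intro: multiple)
    finally have 1: "restrict_keys ?Q p \<in> adjoin (sr_ideal D) (vmon A)" .
    have "p - restrict_keys ?Q p \<in> sr_ideal D"
      using p by (auto simp: sr_ideal_def keys_diff_restrict_keys)
    then have "p - restrict_keys ?Q p \<in> adjoin (sr_ideal D) (vmon A)"
      using ideal_subset_adjoin by blast
    from ideal_add[OF J this 1] show "p \<in> adjoin (sr_ideal D) (vmon A)" by simp
  qed
qed

section \<open>Total degree\<close>

definition total_degree :: "(nat \<Rightarrow>\<^sub>0 nat) \<Rightarrow> nat" where
  "total_degree m = (\<Sum>i\<in>Poly_Mapping.keys m. Poly_Mapping.lookup m i)"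

abbreviation homogeneous_part :: "nat \<Rightarrow> 'k::field mpoly \<Rightarrow> 'k mpoly" where
  "homogeneous_part j p \<equiv> restrict_keys {m. total_degree m = j} p"

definition homogeneous_ideal :: "'k::field mpoly set \<Rightarrow> bool" where
  "homogeneous_ideal J \<longleftrightarrow> is_ideal J \<and> (\<forall>p\<in>J. \<forall>j. homogeneous_part j p \<in> J)"

text \<open>The zero polynomial is homogeneous of every degree.\<close>

definition homogeneous :: "nat \<Rightarrow> 'k::field mpoly \<Rightarrow> bool" where
  "homogeneous e f \<longleftrightarrow> (\<forall>m\<in>Poly_Mapping.keys f. total_degree m = e)"

definition order_ge :: "nat \<Rightarrow> 'k::field mpoly \<Rightarrow> bool" where
  "order_ge k p \<longleftrightarrow> (\<forall>m\<in>Poly_Mapping.keys p. k \<le> total_degree m)"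

lemma total_degree_add: "total_degree (a + b) = total_degree a + total_degree b"
  unfolding total_degree_def by (rule setsum_keys_plus_distrib) simp_all

lemma total_degree_indicator_exponent: "finite A \<Longrightarrow> total_degree (indicator_exponent A) = card A"
  by (simp add: total_degree_def keys_indicator_exponent lookup_indicator_exponent)

lemma order_ge_0: "order_ge 0 p"
  by (simp add: order_ge_def)

lemma order_ge_mult:
  assumes "order_ge k p" "order_ge l q"
  shows "order_ge (k + l) (p * q)"
  unfolding order_ge_def
proof
  fix m assume "m \<in> Poly_Mapping.keys (p * q)"
  then obtain a b where "m = a + b" "a \<in> Poly_Mapping.keys p" "b \<in> Poly_Mapping.keys q"
    using keys_mult[of p q] by blast
  then show "k + l \<le> total_degree m"
    using assms by (auto simp: order_ge_def total_degree_add intro: add_mono)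
qed

lemma order_ge_power: "order_ge 1 p \<Longrightarrow> order_ge k (p ^ k)"
  using order_ge_mult[of 1 p] by (induction k) (auto simp: order_ge_0)

text \<open>Multiplication by a form of degree \<open>e\<close> shifts degrees by \<open>e\<close>;
  the case distinction guards against truncated subtraction in \<open>j - e\<close>.\<close>

lemma homogeneous_part_mult:
  assumes f: "homogeneous e f"
  shows "homogeneous_part j (f * s) = (if e \<le> j then f * homogeneous_part (j - e) s else 0)"
proof -
  have keys: "total_degree m \<in> (+) e ` total_degree ` Poly_Mapping.keys q"
    if "m \<in> Poly_Mapping.keys (f * q)" for m and q :: "'a mpoly"
  proof -
    from that obtain a b where "m = a + b" "a \<in> Poly_Mapping.keys f" "b \<in> Poly_Mapping.keys q"
      using keys_mult[of f q] by blast
    then show ?thesis using f by (auto simp: homogeneous_def total_degree_add)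
  qed
  show ?thesis
  proof (cases "e \<le> j")
    case True
    let ?h = "homogeneous_part (j - e) s"
    have "f * s = f * ?h + f * (s - ?h)" by (simp add: algebra_simps)
    moreover have "homogeneous_part j (f * ?h) = f * ?h"
      using keys[of _ ?h] True by (intro restrict_keys_id) (fastforce simp: keys_restrict_keys)
    moreover have "homogeneous_part j (f * (s - ?h)) = 0"
      using keys[of _ "s - ?h"] True
      by (intro restrict_keys_zero) (fastforce simp: keys_diff_restrict_keys)
    ultimately show ?thesis using True by (simp add: restrict_keys_add)
  next
    case False
    then show ?thesis using keys[of _ s] by (fastforce intro!: restrict_keys_zero)
  qed
qed

lemma homogeneous_adjoin:
  assumes J: "homogeneous_ideal J" and f: "homogeneous e f"
  shows "homogeneous_ideal (adjoin J f)"
  unfolding homogeneous_ideal_def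
proof (intro conjI ballI allI)
  have J': "is_ideal J" using J by (simp add: homogeneous_ideal_def)
  then show "is_ideal (adjoin J f)" by (rule ideal_adjoin)
  fix p j assume "p \<in> adjoin J f"
  then obtain s where "p - f * s \<in> J" by (auto simp: adjoin_def)
  then have h: "homogeneous_part j p - homogeneous_part j (f * s) \<in> J"
    using J by (auto simp: homogeneous_ideal_def restrict_keys_diff[symmetric])
  show "homogeneous_part j p \<in> adjoin J f"
  proof (cases "e \<le> j")
    case True
    then show ?thesis using h unfolding adjoin_def homogeneous_part_mult[OF f] by auto
  next
    case False
    then have "homogeneous_part j p \<in> J" using h unfolding homogeneous_part_mult[OF f] by simp
    then show ?thesis using ideal_subset_adjoin by blast
  qed
qed

lemma homogeneous_ideal_sr_ideal: "down_closed D \<Longrightarrow> homogeneous_ideal (sr_ideal D)"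
  unfolding homogeneous_ideal_def
  by (intro conjI ideal_sr_ideal) (auto simp: sr_ideal_def keys_restrict_keys)

text \<open>A graded Krull intersection theorem: multiples of \<open>x ^ Suc j\<close> have no part
  of degree \<open>j\<close>, so each homogeneous part of \<open>u\<close> lies in
  \<open>J\<close>.\<close>

lemma homogeneous_ideal_separated:
  assumes J: "homogeneous_ideal J" and x: "order_ge 1 x" and u: "\<And>k. u \<in> adjoin J (x ^ k)"
  shows "u \<in> J"
proof -
  have part: "homogeneous_part j u \<in> J" for j
  proof -
    obtain s where s: "u - x ^ Suc j * s \<in> J" using u[of "Suc j"] by (auto simp: adjoin_def)
    have "order_ge (Suc j + 0) (x ^ Suc j * s)"
      by (intro order_ge_mult order_ge_power x order_ge_0)
    then have "homogeneous_part j (x ^ Suc j * s) = 0"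
      by (intro restrict_keys_zero) (auto simp: order_ge_def)
    moreover have "homogeneous_part j (u - x ^ Suc j * s) \<in> J"
      using J s by (simp add: homogeneous_ideal_def)
    ultimately show ?thesis by (simp add: restrict_keys_diff)
  qed
  have "u = (\<Sum>j\<in>total_degree ` Poly_Mapping.keys u. homogeneous_part j u)"
    by (rule poly_mapping_eqI) (auto simp: lookup_sum lookup_restrict_keys in_keys_iff image_iff)
  also have "\<dots> \<in> J" using J part by (intro ideal_sum) (auto simp: homogeneous_ideal_def)
  finally show ?thesis .
qed

text \<open>A graded form of the fact that regular sequences in a local ring may be permuted.\<close>

lemma weakly_regular_lift:
  assumes "homogeneous_ideal J" "order_ge 1 x" "nonzerodivisor_mod J x"
    and "\<forall>f\<in>set fs. \<exists>e. homogeneous e f" "weakly_regular (adjoin J x) fs"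
  shows "weakly_regular J fs"
  using assms
proof (induction fs arbitrary: J)
  case (Cons f fs)
  have J: "is_ideal J" and x: "nonzerodivisor_mod J x" and fx: "nonzerodivisor_mod (adjoin J x) f"
    using Cons.prems by (auto simp: homogeneous_ideal_def)
  obtain e where e: "homogeneous e f" using Cons.prems by auto
  have f: "nonzerodivisor_mod J f"
    unfolding nonzerodivisor_mod_def
  proof (intro allI impI)
    fix u assume u: "f * u \<in> J"
    \<comment> \<open>If \<open>f\<close> kills \<open>u\<close> modulo \<open>J\<close>, then
      \<open>u\<close> is divisible by ever higher powers of \<open>x\<close> modulo
      \<open>J\<close>, which forces \<open>u \<in> J\<close>.\<close>
    have "u \<in> adjoin J (x ^ k)" for k
    proof (induction k)
      case 0
      have "u - x ^ 0 * u \<in> J" by (simp add: ideal_zero[OF J])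
      then show ?case unfolding adjoin_def by blast
    next
      case (Suc k)
      then obtain s where s: "u - x ^ k * s \<in> J" by (auto simp: adjoin_def)
      have "x ^ k * (f * s) = f * u - f * (u - x ^ k * s)" by (simp add: algebra_simps)
      also have "\<dots> \<in> J" by (intro ideal_diff[OF J] u ideal_mult[OF J] s)
      finally have "f * s \<in> J" by (rule nonzerodivisor_modD[OF nonzerodivisor_mod_power[OF x]])
      then have "f * s \<in> adjoin J x" by (rule subsetD[OF ideal_subset_adjoin])
      then have "s \<in> adjoin J x" by (rule nonzerodivisor_modD[OF fx])
      then obtain s' where s': "s - x * s' \<in> J" by (auto simp: adjoin_def)
      have "u - x ^ Suc k * s' = (u - x ^ k * s) + x ^ k * (s - x * s')" by (simp add: algebra_simps)
      also have "\<dots> \<in> J" by (intro ideal_add[OF J] s ideal_mult[OF J] s')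
      finally show ?case unfolding adjoin_def by blast
    qed
    then show "u \<in> J" using homogeneous_ideal_separated[OF Cons.prems(1,2)] by blast
  qed
  \<comment> \<open>Since \<open>colon J x = J\<close>, adjoining \<open>f\<close> commutes with the
    colon, so \<open>x\<close> stays a nonzerodivisor and the induction can continue.\<close>
  have "nonzerodivisor_mod (adjoin J f) x"
    unfolding nonzerodivisor_mod_def
  proof (intro allI impI)
    fix u assume "x * u \<in> adjoin J f"
    then have "u \<in> adjoin (colon J x) f" using colon_adjoin[OF J fx] by (auto simp: colon_def)
    then obtain s where "x * (u - f * s) \<in> J" by (auto simp: adjoin_def colon_def)
    then have "u - f * s \<in> J" by (rule nonzerodivisor_modD[OF x])
    then show "u \<in> adjoin J f" unfolding adjoin_def by blast
  qed
  moreover have "weakly_regular (adjoin (adjoin J f) x) fs"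
    using Cons.prems(5) unfolding adjoin_commute[of J f x] by simp
  ultimately have "weakly_regular (adjoin J f) fs"
    using Cons.prems(2,4) by (intro Cons.IH[OF homogeneous_adjoin[OF Cons.prems(1) e]]) simp_all
  with f show ?case by simp
qed simp

section \<open>Splitting trees and elementary symmetric polynomials\<close>

text \<open>Each split of \<open>D\<close> at \<open>v\<close> is an exact sequence relating \<open>D\<close> to the star and the deletion
  of \<open>v\<close>: these are the complexes of the colon ideal by \<open>x\<^sub>v\<close> and of
  the ideal with \<open>x\<^sub>v\<close> adjoined.\<close>

inductive splits_into_faces :: "nat \<Rightarrow> nat set set \<Rightarrow> bool" for t where
  void: "splits_into_faces t {}"
| simplex: "finite F \<Longrightarrow> t \<le> card F \<Longrightarrow> splits_into_faces t (Pow F)"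
| split: "splits_into_faces t {G. insert v G \<in> D} \<Longrightarrow> splits_into_faces t {G \<in> D. v \<notin> G}
    \<Longrightarrow> splits_into_faces t D"

definition esym :: "nat set \<Rightarrow> nat \<Rightarrow> 'k::field mpoly" where
  "esym U i = (\<Sum>A | A \<subseteq> U \<and> card A = i. vmon A)"

primrec esyms :: "nat set \<Rightarrow> nat \<Rightarrow> 'k::field mpoly list" where
  "esyms U 0 = []"
| "esyms U (Suc t) = esym U (Suc t) # esyms U t"

lemma length_esyms: "length (esyms U t) = t"
  by (induction t) auto

lemma homogeneous_sum: "(\<And>i. i \<in> A \<Longrightarrow> homogeneous e (g i)) \<Longrightarrow> homogeneous e (sum g A)"
  using keys_sum[of g A] by (fastforce simp: homogeneous_def)

lemma homogeneous_vmon: "finite A \<Longrightarrow> homogeneous (card A) (vmon A)"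
  by (simp add: homogeneous_def vmon_def total_degree_indicator_exponent)

lemma homogeneous_esym:
  assumes "finite U" shows "homogeneous i (esym U i)"
  unfolding esym_def
proof (rule homogeneous_sum)
  fix A assume "A \<in> {A. A \<subseteq> U \<and> card A = i}"
  then have "finite A" "card A = i" using assms finite_subset by auto
  then show "homogeneous i (vmon A)" using homogeneous_vmon by blast
qed

lemma homogeneous_esyms: "finite U \<Longrightarrow> \<forall>f\<in>set (esyms U t). \<exists>e. homogeneous e f"
  by (induction t) (auto intro: homogeneous_esym)

lemma down_closed_Pow: "down_closed (Pow F)"
  by (auto simp: down_closed_def)

text \<open>Any other subset of \<open>U\<close> with as many elements as \<open>F\<close> is not
  contained in \<open>F\<close>, so its monomial vanishes on the simplex.\<close>

lemma esym_mod_simplex: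
  assumes U: "finite U" "F \<subseteq> U"
  shows "esym U (card F) - vmon F \<in> sr_ideal (Pow F)"
proof -
  let ?S = "{A. A \<subseteq> U \<and> card A = card F}"
  have S: "finite ?S" "F \<in> ?S" using U by auto
  then have "esym U (card F) - vmon F = (\<Sum>A\<in>?S - {F}. vmon A)"
    by (simp add: esym_def sum_diff1)
  also have "\<dots> \<in> sr_ideal (Pow F)"
  proof (rule ideal_sum[OF ideal_sr_ideal[OF down_closed_Pow]])
    fix A assume A: "A \<in> ?S - {F}"
    then have "finite A" "\<not> A \<subseteq> F"
      using U finite_subset[of A U] finite_subset[of F U] card_subset_eq[of F A] by auto
    then show "vmon A \<in> sr_ideal (Pow F)"
      by (simp add: sr_ideal_def vmon_def keys_indicator_exponent)
  qed
  finally show ?thesis .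
qed

text \<open>Splitting at \<open>v \<in> A\<close> gives, as deletion, the simplex on
  \<open>F - {v}\<close> and, as star, the complex of the same shape with \<open>v\<close> removed
  from \<open>A\<close>. The process ends at \<open>A = {}\<close> with the void complex. The case
  \<open>A = F\<close> is the boundary of the simplex.\<close>

lemma splits_into_faces_boundary:
  assumes "finite F" "finite A" "A \<subseteq> F"
  shows "splits_into_faces (card F - 1) {G. G \<subseteq> F \<and> \<not> A \<subseteq> G}"
  using assms(2,3)
proof (induction A rule: finite_induct)
  case empty
  then show ?case using splits_into_faces.void by simp
next
  case (insert v A)
  have "{G. insert v G \<in> {G. G \<subseteq> F \<and> \<not> insert v A \<subseteq> G}} = {G. G \<subseteq> F \<and> \<not> A \<subseteq> G}"
    using insert by auto
  moreover have "{G \<in> {G. G \<subseteq> F \<and> \<not> insert v A \<subseteq> G}. v \<notin> G} = Pow (F - {v})"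
    by auto
  moreover have "splits_into_faces (card F - 1) (Pow (F - {v}))"
    using insert.prems assms(1) by (intro splits_into_faces.simplex) auto
  ultimately show ?case using insert by (intro splits_into_faces.split[of _ v "{G. G \<subseteq> F \<and> \<not> insert v A \<subseteq> G}"]) simp_all
qed

text \<open>The star of \<open>A\<close> in a simplex containing \<open>A\<close> is the simplex
  itself, so the colon ideal does not change.\<close>

lemma nonzerodivisor_mod_simplex_vmon:
  assumes "finite F" "A \<subseteq> F"
  shows "nonzerodivisor_mod (sr_ideal (Pow F)) (vmon A)"
proof -
  have "{G. A \<union> G \<in> Pow F} = Pow F" using assms by auto
  then have "colon (sr_ideal (Pow F)) (vmon A) = sr_ideal (Pow F)"
    using colon_sr_ideal[of A "Pow F"] assms finite_subset by metis
  then show ?thesis by (auto simp: nonzerodivisor_mod_def colon_def)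
qed

text \<open>If \<open>F\<close> has exactly \<open>t\<close> elements, then \<open>e\<^sub>t\<close> becomes the product of the variables in \<open>F\<close> and leads
  to the boundary of the simplex; this is why the sequence starts with the highest degree.\<close>

lemma weakly_regular_esyms_simplex:
  assumes "finite U" "F \<subseteq> U" "t \<le> card F"
    and IH: "\<And>D t'. t = Suc t' \<Longrightarrow> splits_into_faces t' D \<Longrightarrow> down_closed D \<Longrightarrow> D \<subseteq> Pow U
      \<Longrightarrow> weakly_regular (sr_ideal D :: 'k::field mpoly set) (esyms U t')"
  shows "weakly_regular (sr_ideal (Pow F) :: 'k mpoly set) (esyms U t)"
  using assms(2,3)
proof (induction "card F - t" arbitrary: F)
  case 0
  then have card: "card F = t" by simp
  have F: "finite F" using 0 assms(1) finite_subset by blast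
  show ?case
  proof (cases t)
    case (Suc t')
    let ?e = "esym U t :: 'k mpoly"
    let ?D = "{G \<in> Pow F. \<not> F \<subseteq> G}"
    have e: "?e - vmon F \<in> sr_ideal (Pow F)"
      using esym_mod_simplex[OF assms(1) 0(2)] card by simp
    have J: "is_ideal (sr_ideal (Pow F) :: 'k mpoly set)" by (intro ideal_sr_ideal down_closed_Pow)
    \<comment> \<open>Killing the product of the variables in \<open>F\<close> leaves the boundary
      of the simplex, whose splitting tree has leaves of size at least \<open>t'\<close>. The
      remaining symmetric polynomials are covered by \<open>IH\<close>.\<close>
    have "splits_into_faces t' ?D"
      using splits_into_faces_boundary[OF F F order.refl] card Suc by simp
    moreover have "down_closed ?D" "?D \<subseteq> Pow U" using 0 by (auto simp: down_closed_def)
    ultimately have "weakly_regular (sr_ideal ?D :: 'k mpoly set) (esyms U t')"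
      by (rule IH[OF Suc])
    then have "weakly_regular (adjoin (sr_ideal (Pow F)) ?e) (esyms U t')"
      using adjoin_sr_ideal[OF F down_closed_Pow[of F]] adjoin_cong[OF J e] by metis
    moreover have "nonzerodivisor_mod (sr_ideal (Pow F)) ?e"
      by (intro nonzerodivisor_mod_cong[OF J e] nonzerodivisor_mod_simplex_vmon F order.refl)
    ultimately show ?thesis using Suc by simp
  qed simp
next
  case (Suc k)
  \<comment> \<open>With more than \<open>t\<close> vertices one variable can be killed; the
    sequence is regular on the smaller simplex and lifts back.\<close>
  have F: "finite F" using Suc assms(1) finite_subset by blast
  have "F \<noteq> {}" using Suc by auto
  then obtain v where v: "v \<in> F" by blast
  let ?x = "vmon {v} :: 'k mpoly"
  have "weakly_regular (sr_ideal (Pow (F - {v})) :: 'k mpoly set) (esyms U t)"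
    using Suc v F by (intro Suc.hyps(1)) auto
  moreover have "{G \<in> Pow F. \<not> {v} \<subseteq> G} = Pow (F - {v})" by auto
  ultimately have "weakly_regular (adjoin (sr_ideal (Pow F)) ?x) (esyms U t)"
    using adjoin_sr_ideal[of "{v}", OF _ down_closed_Pow[of F]] by (metis finite.intros)
  moreover have "order_ge 1 ?x" by (simp add: order_ge_def vmon_def total_degree_indicator_exponent)
  moreover have "nonzerodivisor_mod (sr_ideal (Pow F)) ?x"
    using v F by (intro nonzerodivisor_mod_simplex_vmon) auto
  ultimately show ?case
    using homogeneous_esyms[OF assms(1)]
    by (intro weakly_regular_lift[OF homogeneous_ideal_sr_ideal[OF down_closed_Pow]])
qed

text \<open>Two nested inductions: the inner one follows the splitting tree down to its simplices;
  the outer one, on \<open>t\<close>, handles the boundaries that arise there after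
  \<open>e\<^sub>t\<close> has been divided out.\<close>

theorem weakly_regular_esyms:
  assumes "finite U" "splits_into_faces t D" "down_closed D" "D \<subseteq> Pow U"
  shows "weakly_regular (sr_ideal D :: 'k::field mpoly set) (esyms U t)"
  using assms(2-)
proof (induction t arbitrary: D rule: less_induct)
  case (less t)
  have leaf: "weakly_regular (sr_ideal (Pow F) :: 'k mpoly set) (esyms U t)"
    if "F \<subseteq> U" "t \<le> card F" for F
    using less.IH by (intro weakly_regular_esyms_simplex[OF assms(1) that]) auto
  from less.prems show ?case
  proof (induction D rule: splits_into_faces.induct)
    case void
    then show ?case by (simp add: sr_ideal_def weakly_regular_UNIV)
  next
    case (simplex F)
    then show ?case using leaf by auto
  next
    case (split v D)
    have "down_closed {G. insert v G \<in> D}"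
      unfolding down_closed_def
    proof (intro ballI allI impI)
      fix G H assume "G \<in> {G. insert v G \<in> D}" "H \<subseteq> G"
      then have "insert v G \<in> D" "insert v H \<subseteq> insert v G" by auto
      then show "H \<in> {G. insert v G \<in> D}" using down_closedD[OF split.prems(1)] by simp
    qed
    moreover have "down_closed {G \<in> D. v \<notin> G}"
      using down_closedD[OF split.prems(1)] by (auto simp: down_closed_def)
    moreover have "{G. insert v G \<in> D} \<subseteq> Pow U" "{G \<in> D. v \<notin> G} \<subseteq> Pow U"
      using split.prems(2) by auto
    ultimately have "weakly_regular (sr_ideal {G. insert v G \<in> D} :: 'k mpoly set) (esyms U t)"
      "weakly_regular (sr_ideal {G \<in> D. v \<notin> G} :: 'k mpoly set) (esyms U t)"
      by (auto intro!: split.IH)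
    then show ?case
      using weakly_regular_colonI[OF ideal_sr_ideal[OF split.prems(1)], of "vmon {v} :: 'k mpoly" "esyms U t"]
        colon_sr_ideal[of "{v}" D, where 'a = 'k] adjoin_sr_ideal[of "{v}" D, where 'k = 'k] split.prems(1)
      by simp
  qed
qed

section \<open>The complex of vertex sets without a 3-path\<close>

text \<open>Three vertices of the square of a path form a 3-path iff consecutive ones, in increasing
  order, are at distance at most 2.\<close>

definition path_free :: "nat set \<Rightarrow> bool" where
  "path_free G \<longleftrightarrow> \<not> (\<exists>a\<in>G. \<exists>b\<in>G. \<exists>c\<in>G. a < b \<and> b < c \<and> b \<le> a + 2 \<and> c \<le> b + 2)"

text \<open>The vertices of \<open>A\<close> are forced and \<open>V\<close> is what has not been
  deleted. For \<open>A \<subseteq> V\<close> this is the star of \<open>A\<close>: faces may meet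
  \<open>A\<close>, so forced vertices count towards the size of a simplex.\<close>

definition face_link :: "nat set \<Rightarrow> nat set \<Rightarrow> nat set set" where
  "face_link A V = {G. G \<subseteq> V \<and> path_free (A \<union> G)}"

text \<open>For \<open>m \<ge> 2\<close> the summands are the ceiling of \<open>m / 7\<close> and
  one plus the floor of \<open>(m - 2) / 7\<close>. This form avoids truncated subtraction and
  extends to the values 0 and 1 at \<open>m = 0\<close> and \<open>m = 1\<close>, which recursions
  reach.\<close>

definition path_depth :: "nat \<Rightarrow> nat" where
  "path_depth m = (m + 6) div 7 + (m + 5) div 7"

lemma path_free_mono: "path_free G \<Longrightarrow> H \<subseteq> G \<Longrightarrow> path_free H"
  unfolding path_free_def by blast

text \<open>A gap of three leaves no edge between \<open>X\<close> and \<open>Y\<close>, so a 3-path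
  would lie in one of them.\<close>

lemma path_free_Un:
  assumes "path_free X" "path_free Y" "\<And>x y. x \<in> X \<Longrightarrow> y \<in> Y \<Longrightarrow> x + 3 \<le> y"
  shows "path_free (X \<union> Y)"
proof (rule ccontr)
  assume "\<not> path_free (X \<union> Y)"
  then obtain a b c where *: "a \<in> X \<union> Y" "b \<in> X \<union> Y" "c \<in> X \<union> Y"
    "a < b" "b < c" "b \<le> a + 2" "c \<le> b + 2"
    unfolding path_free_def by blast
  show False
  proof (cases "c \<in> X")
    case True
    have "b \<notin> Y" "a \<notin> Y" using assms(3)[OF True, of b] assms(3)[OF True, of a] * by auto
    then show False using * True assms(1) unfolding path_free_def by blast
  next
    case False
    then have c: "c \<in> Y" using * by simp
    have "b \<notin> X" using assms(3)[of b c] c * by auto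
    then have b: "b \<in> Y" using * by simp
    have "a \<notin> X" using assms(3)[of a b] b * by auto
    then show False using * b c assms(2) unfolding path_free_def by blast
  qed
qed

lemma path_free_card_le_2:
  assumes "finite G" "card G \<le> 2" shows "path_free G"
  unfolding path_free_def
proof safe
  fix a b c assume *: "a \<in> G" "b \<in> G" "c \<in> G" "a < b" "b < c"
  then have "card {a, b, c} \<le> card G" by (intro card_mono assms) auto
  with * assms(2) show False by simp
qed

section \<open>Splitting off forced and deleted vertices\<close>

lemma face_link_void: "\<not> path_free A \<Longrightarrow> splits_into_faces t (face_link A V)"
proof -
  assume "\<not> path_free A"
  then have "\<not> path_free (A \<union> G)" for G using path_free_mono[of "A \<union> G" A] by auto
  then have "face_link A V = {}" by (simp add: face_link_def)
  then show ?thesis by (simp add: splits_into_faces.void)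
qed

lemma face_link_simplex:
  assumes "path_free (A \<union> V)" "finite V" "t \<le> card V"
  shows "splits_into_faces t (face_link A V)"
proof -
  have "path_free (A \<union> G)" if "G \<subseteq> V" for G
    using that by (intro path_free_mono[OF assms(1)]) auto
  then have "face_link A V = Pow V" by (auto simp: face_link_def)
  then show ?thesis using assms splits_into_faces.simplex by simp
qed

lemma face_link_split:
  assumes "v \<in> V" "splits_into_faces t (face_link (insert v A) V)"
    "splits_into_faces t (face_link A (V - {v}))"
  shows "splits_into_faces t (face_link A V)"
proof -
  have "{G. insert v G \<in> face_link A V} = face_link (insert v A) V"
    using assms(1) by (auto simp: face_link_def)
  moreover have "{G \<in> face_link A V. v \<notin> G} = face_link A (V - {v})"
    by (auto simp: face_link_def)
  ultimately show ?thesis using assms splits_into_faces.split[of t v "face_link A V"] by simp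
qed

text \<open>Here \<open>k\<close> is the number of further vertices that can be added without
  restriction. Keeping a vertex trades one unit of \<open>k\<close> for one element of
  \<open>A\<close>; deleting is possible while more than \<open>k\<close> free vertices remain. Once
  exactly \<open>k\<close> remain, the complex is a simplex.\<close>

lemma face_link_skeleton:
  assumes "finite V" "A \<subseteq> V" "k \<le> card (V - A)" "t \<le> card A + k"
    and "\<And>B. B \<subseteq> V - A \<Longrightarrow> card B \<le> k \<Longrightarrow> path_free (A \<union> B)"
  shows "splits_into_faces t (face_link A V)"
  using assms
proof (induction "card (V - A)" arbitrary: A V k)
  case 0
  then have "V = A" by auto
  then show ?case using 0(2,4,5) 0(6)[of "{}"] by (intro face_link_simplex) auto
next
  case (Suc m)
  have fin: "finite A" "finite (V - A)" using Suc.prems finite_subset by auto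
  show ?case
  proof (cases "k = card (V - A)")
    case True
    then have "path_free (A \<union> (V - A))" using Suc.prems(5) by blast
    then have "path_free (A \<union> V)" by simp
    moreover have "card V = card A + card (V - A)"
      using Suc.prems(1,2) card_Diff_subset[OF fin(1)] card_mono by fastforce
    ultimately show ?thesis using True Suc.prems by (intro face_link_simplex) auto
  next
    case False
    then have k: "k < card (V - A)" using Suc.prems by simp
    then have "V - A \<noteq> {}" by (metis card.empty not_less0)
    then obtain v where v: "v \<in> V - A" by blast
    have m: "card (V - insert v A) = m" "card (V - {v} - A) = m"
    proof -
      have "V - insert v A = V - A - {v}" "V - {v} - A = V - A - {v}" by auto
      then show "card (V - insert v A) = m" "card (V - {v} - A) = m"
        using Suc.hyps(2) v fin by auto
    qed
    show ?thesis
    proof (rule face_link_split)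
      show "v \<in> V" using v by simp
      show "splits_into_faces t (face_link A (V - {v}))"
        using Suc.prems v k Suc.hyps(2) m by (intro Suc.hyps(1)[where k = k]) auto
      show "splits_into_faces t (face_link (insert v A) V)"
      proof (cases "path_free (insert v A)")
        case False
        then show ?thesis by (rule face_link_void)
      next
        case True
        show ?thesis
        proof (rule Suc.hyps(1)[where k = "k - 1"])
          show "m = card (V - insert v A)" "finite V" "insert v A \<subseteq> V" "k - 1 \<le> card (V - insert v A)"
            using Suc.prems v k Suc.hyps(2) m by auto
          show "t \<le> card (insert v A) + (k - 1)" using Suc.prems(4) v fin by simp
          fix B assume B: "B \<subseteq> V - insert v A" "card B \<le> k - 1"
          then have finB: "finite B" using Suc.prems(1) finite_subset by auto
          show "path_free (insert v A \<union> B)"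
          \<comment> \<open>For \<open>k = 0\<close> truncated subtraction leaves the number at 0;
            \<open>B\<close> is then empty and the case assumption on \<open>insert v A\<close>
            suffices.\<close>
          proof (cases "k = 0")
            case True
            then have "B = {}" using B finB by simp
            then show ?thesis using \<open>path_free (insert v A)\<close> by simp
          next
            case False
            have "card (insert v B) \<le> Suc (card B)" using finB by (simp add: card_insert_if)
            then have "path_free (A \<union> insert v B)"
              using False B v by (intro Suc.prems(5)) auto
            then show ?thesis by simp
          qed
        qed
      qed
    qed
  qed
qed

text \<open>All vertices from \<open>s\<close> up to \<open>s' - 1\<close> are settled: those in
  \<open>K0\<close> are forced by branching, and every other one outside \<open>K\<close> is deleted
  or completes a 3-path with \<open>K0\<close>. The vertices in \<open>K - K0\<close> are cone
  points, and \<open>K\<close> ends early enough not to interact with the tail from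
  \<open>s'\<close> on.\<close>

lemma face_link_jump:
  assumes IH: "\<And>A. path_free A \<Longrightarrow> \<forall>a\<in>A. a + 3 \<le> s' \<Longrightarrow> t \<le> card A + path_depth (Suc n - s')
      \<Longrightarrow> splits_into_faces t (face_link A (A \<union> {s'..n}))"
    and A: "path_free A" "\<forall>a\<in>A. a + 3 \<le> s"
    and K: "K0 \<subseteq> K" "path_free K" "finite K" "\<forall>a\<in>K. s \<le> a \<and> a + 3 \<le> s'" and s: "s \<le> s'"
    and W: "A \<union> K \<union> {s'..n} \<subseteq> W" "W \<subseteq> A \<union> {s..n}"
    and bad: "\<forall>v\<in>{s..<s'}. v \<in> K \<or> v \<notin> W \<or> \<not> path_free (insert v K0)"
    and t: "t \<le> card A + card K + path_depth (Suc n - s')"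
  shows "splits_into_faces t (face_link (A \<union> K0) W)"
proof -
  have AK: "path_free (A \<union> K)" using A K by (intro path_free_Un) fastforce+
  have far: "\<forall>a\<in>A \<union> K. a + 3 \<le> s'" using A K s by auto
  have "finite A" using A(2) by (intro finite_subset[of A "{..s}"]) auto
  moreover have "A \<inter> K = {}" using A K by fastforce
  ultimately have card: "card (A \<union> K) = card A + card K" using K by (simp add: card_Un_disjoint)
  \<comment> \<open>Both sides are the same complex: adding the cone points to the forced set
    changes nothing.\<close>
  have "face_link (A \<union> K0) W = face_link (A \<union> K) (A \<union> K \<union> {s'..n})"
  proof (intro equalityI subsetI)
    fix G assume "G \<in> face_link (A \<union> K0) W"
    then have G: "G \<subseteq> W" "path_free (A \<union> K0 \<union> G)" by (auto simp: face_link_def)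
    have sub: "G \<subseteq> A \<union> K \<union> {s'..n}"
    proof
      fix v assume v: "v \<in> G"
      have "path_free (insert v K0)" using v by (intro path_free_mono[OF G(2)]) auto
      then have "v \<in> K" if "v \<in> {s..<s'}" using bad that v G(1) by auto
      moreover have "v \<in> A \<or> v \<in> {s..n}" using v G(1) W(2) by auto
      ultimately show "v \<in> A \<union> K \<union> {s'..n}" by fastforce
    qed
    have "path_free (G \<inter> {s'..n})" by (rule path_free_mono[OF G(2)]) auto
    then have "path_free (A \<union> K \<union> (G \<inter> {s'..n}))"
    proof (rule path_free_Un[OF AK])
      fix x y assume "x \<in> A \<union> K" "y \<in> G \<inter> {s'..n}"
      then have "x + 3 \<le> s'" "s' \<le> y" using far by auto
      then show "x + 3 \<le> y" by simp
    qed
    then have "path_free (A \<union> K \<union> G)" by (rule path_free_mono) (use sub in auto)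
    with sub show "G \<in> face_link (A \<union> K) (A \<union> K \<union> {s'..n})" by (auto simp: face_link_def)
  next
    fix G assume "G \<in> face_link (A \<union> K) (A \<union> K \<union> {s'..n})"
    then have G: "G \<subseteq> A \<union> K \<union> {s'..n}" "path_free (A \<union> K \<union> G)" by (auto simp: face_link_def)
    have "path_free (A \<union> K0 \<union> G)" by (rule path_free_mono[OF G(2)]) (use K(1) in auto)
    then show "G \<in> face_link (A \<union> K0) W" using G(1) W(1) by (auto simp: face_link_def)
  qed
  moreover have "splits_into_faces t (face_link (A \<union> K) (A \<union> K \<union> {s'..n}))"
    using IH[OF AK far] t card by simp
  ultimately show ?thesis by simp
qed

lemma path_depth_small: "m \<le> 7 \<Longrightarrow> path_depth m \<le> min 2 m"
proof -
  assume "m \<le> 7"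
  then have "m = 0 \<or> m = 1 \<or> m = 2 \<or> m = 3 \<or> m = 4 \<or> m = 5 \<or> m = 6 \<or> m = 7" by arith
  then show ?thesis by (auto simp: path_depth_def)
qed

text \<open>The exchange rates for jumps: two kept vertices pay for seven positions, three for
  eight.\<close>

lemma
  shows path_depth_le_7: "m \<le> m' + 7 \<Longrightarrow> path_depth m \<le> path_depth m' + 2"
    and path_depth_le_8: "m \<le> m' + 8 \<Longrightarrow> path_depth m \<le> path_depth m' + 3"
proof -
  have step: "x div 7 \<le> Suc (y div 7)" if "x \<le> y + 7" for x y :: nat
    using div_le_mono[OF that, of 7] by simp
  show "path_depth m \<le> path_depth m' + 2" if "m \<le> m' + 7"
    using step[of "m + 6" "m' + 6"] step[of "m + 5" "m' + 5"] that unfolding path_depth_def by simp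
  show "path_depth m \<le> path_depth m' + 3" if "m \<le> m' + 8"
    using step[of "m + 6" "m' + 7"] step[of "m + 5" "m' + 6"] step[of "m' + 7" "m'"]
      div_le_mono[of m' "m' + 5" 7] that unfolding path_depth_def by simp
qed

text \<open>Lets the finite case analysis be done with numeral offsets from
  \<open>s\<close>.\<close>

lemma path_free_shift: "path_free ((+) s ` G) \<longleftrightarrow> path_free G"
  by (simp add: path_free_def add.assoc)

text \<open>Branch first on the third vertex and, if it is deleted, on the fourth one; every branch ends
  with at least two kept vertices among the first seven, or with three among the first eight, after which the
  rest of the path is untouched.\<close>

lemma splits_into_faces_path:
  assumes "path_free A" "\<forall>a\<in>A. a + 3 \<le> s" "t \<le> card A + path_depth (Suc n - s)"
  shows "splits_into_faces t (face_link A (A \<union> {s..n}))"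
  using assms
proof (induction "Suc n - s" arbitrary: A s rule: less_induct)
  case less
  have finA: "finite A" using less.prems(2) by (intro finite_subset[of A "{..s}"]) auto
  show ?case
  proof (cases "Suc n - s \<le> 7")
    case True
    have d: "A \<union> {s..n} - A = {s..n}" using less.prems(2) by fastforce
    \<comment> \<open>At most seven vertices remain. Any two of them may be added, and
      \<open>path_depth\<close> asks for no more than that.\<close>
    show ?thesis
    proof (rule face_link_skeleton[where k = "min 2 (Suc n - s)"])
      show "t \<le> card A + min 2 (Suc n - s)"
        using less.prems(3) path_depth_small[OF True] by linarith
      fix B assume B: "B \<subseteq> A \<union> {s..n} - A" "card B \<le> min 2 (Suc n - s)"
      then have "finite B" unfolding d using finite_subset by blast
      then have "path_free B" using B by (intro path_free_card_le_2) auto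
      then show "path_free (A \<union> B)"
        using B less.prems(1,2) unfolding d by (intro path_free_Un) fastforce+
    qed (use finA in \<open>auto simp: d\<close>)
  next
    case False
    \<comment> \<open>\<open>L\<close> holds the offsets of the forced vertices, \<open>Y\<close>
      those of the deleted ones.\<close>
    define branch where "branch L Y \<longleftrightarrow>
        splits_into_faces t (face_link (A \<union> (+) s ` L) (A \<union> ({s..n} - (+) s ` Y)))" for L Y
    \<comment> \<open>\<open>L0\<close> is forced, \<open>L\<close> adds the cone points, and
      \<open>c\<close> is the number of settled positions; the last condition is the exchange
      rate.\<close>
    have jump: "branch L0 Y"
      if L: "L0 \<subseteq> L" "path_free L" "finite L" "\<forall>i\<in>L. i + 3 \<le> c" "L \<inter> Y = {}" "\<forall>i\<in>Y. i < c"
        and bad: "\<forall>i<c. i \<in> L \<or> i \<in> Y \<or> \<not> path_free (insert i L0)"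
        and c: "0 < c" "c \<le> 7 \<and> 2 \<le> card L \<or> c \<le> 8 \<and> 3 \<le> card L" for L0 L Y c
      unfolding branch_def
    proof (rule face_link_jump[where s = s and s' = "s + c" and K = "(+) s ` L"])
      have card: "card ((+) s ` L) = card L" by (simp add: card_image)
      have "path_depth (Suc n - s) \<le> path_depth (Suc n - (s + c)) + card L"
        using c(2)
      proof
        assume "c \<le> 7 \<and> 2 \<le> card L"
        then show ?thesis using path_depth_le_7[of "Suc n - s" "Suc n - (s + c)"] by linarith
      next
        assume "c \<le> 8 \<and> 3 \<le> card L"
        then show ?thesis using path_depth_le_8[of "Suc n - s" "Suc n - (s + c)"] by linarith
      qed
      then show "t \<le> card A + card ((+) s ` L) + path_depth (Suc n - (s + c))"
        using less.prems(3) card by linarith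
      show "splits_into_faces t (face_link A' (A' \<union> {s + c..n}))"
        if "path_free A'" "\<forall>a\<in>A'. a + 3 \<le> s + c" "t \<le> card A' + path_depth (Suc n - (s + c))" for A'
        using that c False by (intro less.hyps) auto
      show "\<forall>v\<in>{s..<s + c}. v \<in> (+) s ` L \<or> v \<notin> A \<union> ({s..n} - (+) s ` Y)
          \<or> \<not> path_free (insert v ((+) s ` L0))"
      proof
        fix v assume v: "v \<in> {s..<s + c}"
        define i where "i = v - s"
        have i: "v = s + i" "i < c" using v by (auto simp: i_def)
        have "v \<notin> A" using v less.prems(2) by fastforce
        moreover have "path_free (insert v ((+) s ` L0)) \<longleftrightarrow> path_free (insert i L0)"
          using path_free_shift[of s "insert i L0"] i(1) by simp
        ultimately show "v \<in> (+) s ` L \<or> v \<notin> A \<union> ({s..n} - (+) s ` Y)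
            \<or> \<not> path_free (insert v ((+) s ` L0))"
          using bad i by auto
      qed
      show "A \<union> (+) s ` L \<union> {s + c..n} \<subseteq> A \<union> ({s..n} - (+) s ` Y)"
        using L c False by fastforce
    qed (use L less.prems path_free_shift in auto)
    have split: "branch L Y" if "v \<le> 7" "v \<notin> Y" "branch (insert v L) Y" "branch L (insert v Y)" for v L Y
      unfolding branch_def
    proof (rule face_link_split[of "s + v"])
      have "s + v \<notin> A" using less.prems(2) by fastforce
      then have "A \<union> ({s..n} - (+) s ` Y) - {s + v} = A \<union> ({s..n} - (+) s ` insert v Y)" by auto
      then show "splits_into_faces t (face_link (A \<union> (+) s ` L) (A \<union> ({s..n} - (+) s ` Y) - {s + v}))"
        using that(4) by (simp add: branch_def)
    qed (use that False in \<open>auto simp: branch_def\<close>)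
    have "branch {} {}"
    proof (rule split[of 2])
      show "branch {2} {}"
      proof (rule split[of 4])
        \<comment> \<open>Each other offset below 7 completes a 3-path with 2 and 4.\<close>
        show "branch {4, 2} {}"
          by (rule jump[of _ "{4, 2}" 7]) (auto simp: path_free_def eval_nat_numeral less_Suc_eq)
        show "branch {2} {4}"
        proof (rule split[of 3])
          show "branch {3, 2} {4}"
            by (rule jump[of _ "{3, 2}" 6]) (auto simp: path_free_def eval_nat_numeral less_Suc_eq)
          show "branch {2} {3, 4}"
          proof (rule split[of 0])
            show "branch {0, 2} {3, 4}"
              by (rule jump[of _ "{0, 2}" 5]) (auto simp: path_free_def eval_nat_numeral less_Suc_eq)
            \<comment> \<open>With 0, 3 and 4 deleted, offset 1 is a cone point.\<close>
            show "branch {2} {0, 3, 4}"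
              by (rule jump[of _ "{1, 2}" 5]) (auto simp: path_free_def eval_nat_numeral less_Suc_eq)
          qed auto
        qed auto
      qed auto
      show "branch {} {2}"
      proof (rule split[of 3])
        show "branch {3} {2}"
        proof (rule split[of 5])
          \<comment> \<open>The edge at 3 and 5 blocks everything up to 7, so eight positions are
            used; the free offset 0 supplies the third vertex.\<close>
          show "branch {5, 3} {2}"
            by (rule jump[of _ "{0, 5, 3}" 8]) (auto simp: path_free_def eval_nat_numeral less_Suc_eq)
          show "branch {3} {5, 2}"
          proof (rule split[of 4])
            show "branch {4, 3} {5, 2}"
              by (rule jump[of _ "{0, 4, 3}" 7]) (auto simp: path_free_def eval_nat_numeral less_Suc_eq)
            show "branch {3} {4, 5, 2}"
            proof (rule split[of 0])
              show "branch {0, 3} {4, 5, 2}"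
                by (rule jump[of _ "{0, 3}" 6]) (auto simp: path_free_def eval_nat_numeral less_Suc_eq)
              show "branch {3} {0, 4, 5, 2}"
                by (rule jump[of _ "{1, 3}" 6]) (auto simp: path_free_def eval_nat_numeral less_Suc_eq)
            qed auto
          qed auto
        qed auto
        \<comment> \<open>Deleting offsets 2 and 3 isolates the first two vertices, which become
          cone points.\<close>
        show "branch {} {3, 2}"
          by (rule jump[of _ "{0, 1}" 4]) (auto simp: path_free_def eval_nat_numeral less_Suc_eq)
      qed auto
    qed auto
    then show ?thesis by (simp add: branch_def)
  qed
qed

text \<open>Blocks of seven are appended on the right: the edge \<open>{m + 3, m + 5}\<close>
  dominates \<open>m + 1, ..., m + 7\<close> and is at distance at least 3 from the first
  \<open>m\<close> vertices. The remaining at most six vertices are settled by hand.\<close>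

lemma path_free_maximal_face:
  "\<exists>F\<subseteq>{1..n}. path_free F \<and> card F = path_depth n \<and> (\<forall>v\<in>{1..n} - F. \<not> path_free (insert v F))"
proof (induction n rule: less_induct)
  case (less n)
  show ?case
  proof (cases "n \<le> 6")
    case True
    then have "n = 0 \<or> n = 1 \<or> n \<in> {2, 3, 4} \<or> n \<in> {5, 6}" by auto
    then show ?thesis
    proof (elim disjE)
      assume "n = 0"
      then show ?thesis by (intro exI[of _ "{}"]) (auto simp: path_free_def path_depth_def)
    next
      assume "n = 1"
      then show ?thesis by (intro exI[of _ "{1}"]) (auto simp: path_free_def path_depth_def)
    next
      assume "n \<in> {2, 3, 4}"
      then show ?thesis
        by (intro exI[of _ "{1, 2}"]) (auto simp: path_free_def path_depth_def atLeastAtMost_iff)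
    next
      assume "n \<in> {5, 6}"
      then show ?thesis
        by (intro exI[of _ "{3, 5}"]) (auto simp: path_free_def path_depth_def atLeastAtMost_iff)
    qed
  next
    case False
    define m where "m = n - 7"
    have n: "n = m + 7" using False by (simp add: m_def)
    obtain F where F: "F \<subseteq> {1..m}" "path_free F" "card F = path_depth m"
      "\<And>v. v \<in> {1..m} - F \<Longrightarrow> \<not> path_free (insert v F)"
      using less.IH[of m] n by auto
    let ?F = "F \<union> {m + 3, m + 5}"
    have "?F \<subseteq> {1..n}" using F(1) n by auto
    moreover have "path_free ?F"
      using F(1) by (intro path_free_Un[OF F(2)] path_free_card_le_2) auto
    moreover have "card ?F = path_depth n"
    proof -
      have "F \<inter> {m + 3, m + 5} = {}" "finite F" using F(1) finite_subset by auto
      then have "card ?F = card F + card {m + 3, m + 5}" by (intro card_Un_disjoint) auto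
      also have "\<dots> = path_depth m + 2" using F(3) by simp
      also have "\<dots> = path_depth n"
        using div_add_self2[of 7 "m + 6"] div_add_self2[of 7 "m + 5"]
        unfolding n path_depth_def by (simp add: add.commute add.left_commute)
      finally show ?thesis .
    qed
    moreover have "\<not> path_free (insert v ?F)" if v: "v \<in> {1..n} - ?F" for v
    proof (cases "v \<le> m")
      case True
      then have "\<not> path_free (insert v F)" using v F(4) by auto
      then show ?thesis using path_free_mono[of "insert v ?F" "insert v F"] by auto
    next
      case False
      then have "v = m + 1 \<or> v = m + 2 \<or> v = m + 4 \<or> v = m + 6 \<or> v = m + 7" using v n by auto
      then have "\<not> path_free {v, m + 3, m + 5}" by (auto simp: path_free_def)
      then show ?thesis using path_free_mono[of "insert v ?F" "{v, m + 3, m + 5}"] by auto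
    qed
    ultimately show ?thesis by blast
  qed
qed

section \<open>Regular sequences are no longer than a facet\<close>

lemma homogeneous_system_nontrivial_solution:
  fixes M :: "'a \<Rightarrow> 'b \<Rightarrow> 'k::field"
  assumes "finite B" "finite A" "card B < card A"
  shows "\<exists>c. (\<exists>a\<in>A. c a \<noteq> 0) \<and> (\<forall>b\<in>B. (\<Sum>a\<in>A. c a * M a b) = 0)"
  using assms
proof (induction B arbitrary: A M rule: finite_induct)
  case empty
  then have "A \<noteq> {}" by auto
  then show ?case by (intro exI[of _ "\<lambda>_. 1"]) auto
next
  case (insert b B)
  show ?case
  proof (cases "\<forall>a\<in>A. M a b = 0")
    case True
    obtain c where "\<exists>a\<in>A. c a \<noteq> 0" "\<forall>b\<in>B. (\<Sum>a\<in>A. c a * M a b) = 0"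
      using insert.IH[of A M] insert.prems insert.hyps by auto
    then show ?thesis using True by (intro exI[of _ c]) auto
  next
    case False
    then obtain e where e: "e \<in> A" "M e b \<noteq> 0" by blast
    let ?A = "A - {e}"
    let ?M = "\<lambda>a b'. M a b' - M a b / M e b * M e b'"
    have "finite ?A" "card B < card ?A" using insert e by auto
    then obtain c where c: "\<exists>a\<in>?A. c a \<noteq> 0" "\<And>b'. b' \<in> B \<Longrightarrow> (\<Sum>a\<in>?A. c a * ?M a b') = 0"
      using insert.IH[of ?A ?M] by blast
    define S where "S = (\<Sum>a\<in>?A. c a * M a b)"
    \<comment> \<open>Gaussian elimination with pivot \<open>M e b\<close>: the coefficient at
      \<open>e\<close> is solved from equation \<open>b\<close>, and the reduced matrix accounts for
      the other equations.\<close>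
    define c' where "c' a = (if a = e then - S / M e b else c a)" for a
    have sum: "(\<Sum>a\<in>A. c' a * M a b') = (\<Sum>a\<in>?A. c a * M a b') - S / M e b * M e b'" for b'
    proof -
      have "(\<Sum>a\<in>A. c' a * M a b') = c' e * M e b' + (\<Sum>a\<in>?A. c' a * M a b')"
        using e insert.prems by (simp add: sum.remove)
      also have "(\<Sum>a\<in>?A. c' a * M a b') = (\<Sum>a\<in>?A. c a * M a b')"
        by (rule sum.cong) (auto simp: c'_def)
      finally show ?thesis by (simp add: c'_def)
    qed
    have "(\<Sum>a\<in>A. c' a * M a b') = 0" if "b' \<in> insert b B" for b'
    proof (cases "b' = b")
      case True
      then show ?thesis using e by (simp add: sum S_def)
    next
      case False
      have "(\<Sum>a\<in>?A. c a * ?M a b') = (\<Sum>a\<in>?A. c a * M a b') - S / M e b * M e b'"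
        by (simp add: S_def algebra_simps sum_subtractf sum_distrib_left sum_divide_distrib)
      then show ?thesis using c(2)[of b'] that False by (simp add: sum)
    qed
    moreover have "\<exists>a\<in>A. c' a \<noteq> 0" using c(1) by (auto simp: c'_def)
    ultimately show ?thesis by blast
  qed
qed

section \<open>Bounds on exponents and the number of monomials in a box\<close>

definition exponents_le :: "nat \<Rightarrow> 'k::field mpoly \<Rightarrow> bool" where
  "exponents_le N p \<longleftrightarrow> (\<forall>m\<in>Poly_Mapping.keys p. \<forall>v. Poly_Mapping.lookup m v \<le> N)"

lemma exponents_le_mono: "exponents_le N p \<Longrightarrow> N \<le> N' \<Longrightarrow> exponents_le N' p"
  unfolding exponents_le_def using order_trans by blast

lemma exponents_le_one: "exponents_le N 1"
  by (simp add: exponents_le_def)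

lemma exponents_le_mult:
  assumes "exponents_le N p" "exponents_le N' q"
  shows "exponents_le (N + N') (p * q)"
  unfolding exponents_le_def
proof
  fix m assume "m \<in> Poly_Mapping.keys (p * q)"
  then obtain a b where "m = a + b" "a \<in> Poly_Mapping.keys p" "b \<in> Poly_Mapping.keys q"
    using keys_mult[of p q] by blast
  then show "\<forall>v. Poly_Mapping.lookup m v \<le> N + N'"
    using assms by (auto simp: exponents_le_def lookup_add intro: add_mono)
qed

lemma exponents_le_power: "exponents_le N p \<Longrightarrow> exponents_le (k * N) (p ^ k)"
  by (induction k) (auto simp: exponents_le_one intro: exponents_le_mult)

text \<open>What matters is that the bound is linear in \<open>s\<close>, while the number of power
  products grows like \<open>s ^ length fs\<close>.\<close>

lemma exponents_le_power_product:
  assumes "\<forall>f\<in>set fs. exponents_le N f" "as \<in> exponent_lists s (length fs)"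
  shows "exponents_le (length fs * s * N) (power_product fs as)"
  using assms
proof (induction fs arbitrary: as)
  case Nil
  then show ?case by (simp add: power_product_def exponents_le_one)
next
  case (Cons f fs)
  then obtain a as' where as: "as = a # as'" "a < s" "as' \<in> exponent_lists s (length fs)"
    by (cases as) (auto simp: exponent_lists_def)
  have "exponents_le (s * N) (f ^ a)"
    using Cons.prems as exponents_le_power[of N f a] exponents_le_mono[of "a * N" "f ^ a" "s * N"] by simp
  from exponents_le_mult[OF this Cons.IH[OF _ as(3)]] Cons.prems show ?case
    by (simp add: as power_product_def algebra_simps)
qed

lemma exponents_le_exists: "\<exists>N. \<forall>f\<in>set fs. exponents_le N f"
proof (induction fs)
  case (Cons f fs)
  then obtain N where N: "\<forall>f\<in>set fs. exponents_le N f" by blast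
  let ?K = "Max (insert N (\<Union>m\<in>Poly_Mapping.keys f. Poly_Mapping.lookup m ` Poly_Mapping.keys m))"
  have fin: "finite (insert N (\<Union>m\<in>Poly_Mapping.keys f. Poly_Mapping.lookup m ` Poly_Mapping.keys m))"
    by auto
  have "exponents_le ?K f"
    unfolding exponents_le_def
  proof (intro ballI allI)
    fix m v assume m: "m \<in> Poly_Mapping.keys f"
    show "Poly_Mapping.lookup m v \<le> ?K"
    proof (cases "v \<in> Poly_Mapping.keys m")
      case True
      then show ?thesis using m fin by (intro Max_ge) auto
    qed (simp add: in_keys_iff)
  qed
  moreover have "exponents_le ?K g" if "g \<in> set fs" for g
  proof (rule exponents_le_mono)
    show "exponents_le N g" using N that by simp
    show "N \<le> ?K" using fin by (intro Max_ge) auto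
  qed
  ultimately show ?case by (intro exI[of _ ?K]) auto
qed simp

lemma card_bounded_monomials:
  fixes F :: "nat set" and N :: nat
  assumes "finite F"
  defines "B \<equiv> {m :: nat \<Rightarrow>\<^sub>0 nat. Poly_Mapping.keys m \<subseteq> F \<and> (\<forall>v. Poly_Mapping.lookup m v < N)}"
  shows "finite B" "card B \<le> N ^ card F"
proof -
  let ?g = "\<lambda>m. restrict (Poly_Mapping.lookup m) F"
  have inj: "inj_on ?g B"
  proof (rule inj_onI)
    fix m m' assume m: "m \<in> B" "m' \<in> B" "?g m = ?g m'"
    show "m = m'"
    proof (rule poly_mapping_eqI)
      fix v
      show "Poly_Mapping.lookup m v = Poly_Mapping.lookup m' v"
      proof (cases "v \<in> F")
        case True
        then show ?thesis using fun_cong[OF m(3), of v] by simp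
      next
        case False
        then have "v \<notin> Poly_Mapping.keys m" "v \<notin> Poly_Mapping.keys m'" using m by (auto simp: B_def)
        then show ?thesis by (simp add: in_keys_iff)
      qed
    qed
  qed
  have sub: "?g ` B \<subseteq> PiE F (\<lambda>_. {..<N})" by (auto simp: B_def)
  have fin: "finite (PiE F (\<lambda>_. {..<N}))" using assms(1) by (intro finite_PiE) auto
  show "finite B" using finite_imageD[OF finite_subset[OF sub fin] inj] .
  show "card B \<le> N ^ card F"
    using card_inj_on_le[OF inj sub fin] assms(1) by (simp add: card_PiE)
qed

text \<open>Multiples of polynomials of order above the degree of \<open>m\<close> have no term at
  \<open>m\<close>, so adjoining them to \<open>J\<close> creates none.\<close>

lemma foldl_adjoin_coefficient_zero:
  assumes "\<forall>p\<in>J. Poly_Mapping.lookup p m = 0" "\<forall>f\<in>set fs. order_ge (Suc (total_degree m)) f"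
    "p \<in> foldl adjoin J fs"
  shows "Poly_Mapping.lookup p m = 0"
  using assms
proof (induction fs arbitrary: J)
  case (Cons f fs)
  have "\<forall>p\<in>adjoin J f. Poly_Mapping.lookup p m = 0"
  proof
    fix p assume "p \<in> adjoin J f"
    then obtain s where s: "p - f * s \<in> J" by (auto simp: adjoin_def)
    have "order_ge (Suc (total_degree m) + 0) (f * s)"
      using Cons.prems by (intro order_ge_mult order_ge_0) auto
    then have "m \<notin> Poly_Mapping.keys (f * s)" by (auto simp: order_ge_def)
    then have "Poly_Mapping.lookup (f * s) m = 0" by (simp add: in_keys_iff)
    then show "Poly_Mapping.lookup p m = 0" using Cons.prems(1) s by (fastforce simp: lookup_minus)
  qed
  then show ?case using Cons by auto
qed auto

theorem weakly_regular_length_le: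
  fixes fs :: "'k::field mpoly list"
  assumes D: "down_closed D" and F: "finite F" "F \<in> D" "\<And>v. v \<notin> F \<Longrightarrow> insert v F \<notin> D"
    and fs: "weakly_regular (sr_ideal D) fs" "\<forall>f\<in>set fs. order_ge 1 f"
  shows "length fs \<le> card F"
proof (rule ccontr)
  assume "\<not> length fs \<le> card F"
  then have r: "Suc (card F) \<le> length fs" by simp
  \<comment> \<open>The exponent exceeds the degree of the facet monomial, so the ideal generated by
    the powers cannot reach it.\<close>
  define gs where "gs = map (\<lambda>f. f ^ Suc (card F)) fs"
  define r where "r = length gs"
  have J: "is_ideal (sr_ideal D :: 'k mpoly set)" by (rule ideal_sr_ideal[OF D])
  have gs: "weakly_regular (sr_ideal D) gs"
    unfolding gs_def by (rule weakly_regular_powers[OF J fs(1)])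
  have rF: "Suc (card F) \<le> r" using r by (simp add: r_def gs_def)
  let ?w = "vmon F :: 'k mpoly" and ?m = "indicator_exponent F"
  have w: "?w \<notin> foldl adjoin (sr_ideal D) gs"
  proof
    assume "?w \<in> foldl adjoin (sr_ideal D) gs"
    moreover have "\<forall>p\<in>sr_ideal D. Poly_Mapping.lookup (p :: 'k mpoly) ?m = 0"
      using F(2) keys_indicator_exponent[OF F(1)] unfolding sr_ideal_def
      by (metis (mono_tags, lifting) in_keys_iff mem_Collect_eq)
    moreover have "\<forall>g\<in>set gs. order_ge (Suc (total_degree ?m)) g"
      using fs(2) order_ge_power[of _ "Suc (card F)"]
      by (auto simp: gs_def total_degree_indicator_exponent F(1) simp del: power_Suc)
    ultimately have "Poly_Mapping.lookup ?w ?m = 0"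
      using foldl_adjoin_coefficient_zero by blast
    then show False by (simp add: vmon_def)
  qed
  obtain N where N: "\<forall>g\<in>set gs. exponents_le N g" using exponents_le_exists by blast
  \<comment> \<open>Exponents in a power product are at most \<open>r * s * N < C * s\<close>. As
    \<open>s > C ^ card F\<close> and \<open>r > card F\<close>, the box contains at most
    \<open>(C * s) ^ card F < s ^ r\<close> monomials.\<close>
  define C where "C = Suc (r * N)"
  define s where "s = Suc (C ^ card F)"
  let ?A = "exponent_lists s r"
  let ?B = "{m :: nat \<Rightarrow>\<^sub>0 nat. Poly_Mapping.keys m \<subseteq> F \<and> (\<forall>v. Poly_Mapping.lookup m v < C * s)}"
  have "card ?B \<le> (C * s) ^ card F" by (rule card_bounded_monomials(2)[OF F(1)])
  also have "\<dots> = C ^ card F * s ^ card F" by (rule power_mult_distrib)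
  also have "\<dots> < s * s ^ card F" by (intro mult_strict_right_mono) (simp_all add: s_def)
  also have "\<dots> \<le> s ^ r" using rF by (simp add: s_def power_increasing flip: power_Suc)
  also have "\<dots> = card ?A" by (simp add: card_exponent_lists)
  finally have "card ?B < card ?A" .
  from homogeneous_system_nontrivial_solution[OF card_bounded_monomials(1)[OF F(1)] finite_exponent_lists this,
      where M = "\<lambda>as. Poly_Mapping.lookup (power_product gs as)"]
  obtain c where c: "\<exists>as\<in>?A. c as \<noteq> 0"
      "\<forall>m\<in>?B. (\<Sum>as\<in>?A. c as * Poly_Mapping.lookup (power_product gs as) m) = 0"
    by blast
  \<comment> \<open>A nontrivial combination with no monomial supported in \<open>F\<close>: inside
    the box by the choice of \<open>c\<close>, outside it by the exponent bound.\<close>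
  define P where "P = (\<Sum>as\<in>?A. Poly_Mapping.single 0 (c as) * power_product gs as)"
  have lookup_P: "Poly_Mapping.lookup P m = (\<Sum>as\<in>?A. c as * Poly_Mapping.lookup (power_product gs as) m)" for m
    using lookup_single_mult_add[of "0 :: nat \<Rightarrow>\<^sub>0 nat", where 'b = 'k] by (simp add: P_def lookup_sum)
  have P: "\<not> Poly_Mapping.keys m \<subseteq> F" if "m \<in> Poly_Mapping.keys P" for m
  proof
    assume m: "Poly_Mapping.keys m \<subseteq> F"
    from that have "Poly_Mapping.lookup P m \<noteq> 0" by (simp add: in_keys_iff)
    then obtain as where as: "as \<in> ?A" "Poly_Mapping.lookup (power_product gs as) m \<noteq> 0"
      unfolding lookup_P by (metis (no_types, lifting) mult_zero_right sum.neutral)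
    have "exponents_le (r * s * N) (power_product gs as)"
      using exponents_le_power_product[OF N] as(1) by (simp add: r_def)
    then have "Poly_Mapping.lookup m v \<le> r * s * N" for v
      using as(2) by (auto simp: exponents_le_def in_keys_iff)
    moreover have "r * s * N < C * s" by (simp add: C_def s_def algebra_simps)
    ultimately have "m \<in> ?B" using m le_less_trans by blast
    then show False using c(2) \<open>Poly_Mapping.lookup P m \<noteq> 0\<close> lookup_P by simp
  qed
  \<comment> \<open>Each monomial of \<open>P\<close> has a variable outside the facet
    \<open>F\<close>, so multiplying by \<open>w\<close> turns its support into a nonface.\<close>
  have "?w * P \<in> sr_ideal D"
    unfolding sr_ideal_def mem_Collect_eq
  proof
    fix m assume "m \<in> Poly_Mapping.keys (?w * P)"
    then obtain m' where m': "m' \<in> Poly_Mapping.keys P" "m = ?m + m'"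
      by (auto simp: vmon_def keys_single_one_mult)
    then obtain v where "v \<in> Poly_Mapping.keys m'" "v \<notin> F" using P by blast
    moreover have "Poly_Mapping.keys m = F \<union> Poly_Mapping.keys m'"
      by (simp add: m' keys_nat_add keys_indicator_exponent F(1))
    ultimately show "Poly_Mapping.keys m \<notin> D"
      using F(3)[of v] down_closedD[OF D, of "Poly_Mapping.keys m" "insert v F"] by auto
  qed
  then have "(\<Sum>as\<in>exponent_lists s (length gs). Poly_Mapping.single 0 (c as) * power_product gs as) * ?w
      \<in> sr_ideal D"
    by (simp add: P_def r_def mult.commute)
  moreover have "Poly_Mapping.single 0 x = 0 \<or> Poly_Mapping.single 0 x dvd (1 :: 'k mpoly)" for x
  proof (cases "x = 0")
    case False
    then have "(1 :: 'k mpoly) = Poly_Mapping.single 0 x * Poly_Mapping.single 0 (inverse x)"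
      by (simp add: mult_single)
    then show ?thesis by (metis dvdI)
  qed simp
  ultimately have "\<forall>as\<in>exponent_lists s (length gs). Poly_Mapping.single 0 (c as) = (0 :: 'k mpoly)"
    by (intro weakly_regular_imp_independent[OF J gs w])
  then have "\<forall>as\<in>?A. c as = 0" by (metis lookup_single_eq lookup_zero r_def)
  with c(1) show False by blast
qed

section \<open>Comparison with the polynomial ring in finitely many variables\<close>

lemma carrier_mpoly_ring:
  "p \<in> carrier (mpoly_ring n) \<longleftrightarrow> (\<forall>m\<in>Poly_Mapping.keys p. Poly_Mapping.keys m \<subseteq> {1..n})"
  by (simp add: mpoly_ring_def)

lemma mpoly_ring_ops:
  "p \<oplus>\<^bsub>mpoly_ring n\<^esub> q = p + q" "p \<otimes>\<^bsub>mpoly_ring n\<^esub> q = p * q"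
  "\<zero>\<^bsub>mpoly_ring n\<^esub> = 0" "\<one>\<^bsub>mpoly_ring n\<^esub> = 1"
  by (simp_all add: mpoly_ring_def)

lemma mpoly_ring_a_inv:
  assumes "p \<in> carrier (mpoly_ring n :: 'k::field mpoly ring)"
  shows "\<ominus>\<^bsub>mpoly_ring n\<^esub> p = - p"
proof -
  interpret cring "mpoly_ring n :: 'k mpoly ring" by (rule mpoly_ring_is_cring)
  have "- p \<in> carrier (mpoly_ring n)" using assms by (simp add: carrier_mpoly_ring)
  then show ?thesis using assms by (intro minus_equality) (simp_all add: mpoly_ring_ops)
qed

lemma mpoly_ring_a_minus:
  assumes "q \<in> carrier (mpoly_ring n :: 'k::field mpoly ring)"
  shows "p \<ominus>\<^bsub>mpoly_ring n\<^esub> q = p - q"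
  using assms by (simp add: a_minus_def mpoly_ring_ops mpoly_ring_a_inv)

lemma finsum_mpoly_ring:
  assumes "g \<in> A \<rightarrow> carrier (mpoly_ring n :: 'k::field mpoly ring)"
  shows "finsum (mpoly_ring n) g A = sum g A"
proof -
  interpret cring "mpoly_ring n :: 'k mpoly ring" by (rule mpoly_ring_is_cring)
  show ?thesis
    using assms
    by (induction A rule: infinite_finite_induct) (auto simp: mpoly_ring_ops Pi_def)
qed

lemma ideal_sr_ideal_carrier:
  assumes D: "down_closed D"
  shows "ideal (sr_ideal D \<inter> carrier (mpoly_ring n)) (mpoly_ring n :: 'k::field mpoly ring)"
proof -
  interpret cring "mpoly_ring n :: 'k mpoly ring" by (rule mpoly_ring_is_cring)
  have J: "is_ideal (sr_ideal D :: 'k mpoly set)" by (rule ideal_sr_ideal[OF D])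
  show ?thesis
  proof (rule idealI)
    show "subgroup (sr_ideal D \<inter> carrier (mpoly_ring n)) (add_monoid (mpoly_ring n :: 'k mpoly ring))"
    proof (rule group.subgroupI)
      show "group (add_monoid (mpoly_ring n :: 'k mpoly ring))" by (rule a_group)
      show "sr_ideal D \<inter> carrier (mpoly_ring n) \<noteq> ({} :: 'k mpoly set)"
        using ideal_zero[OF J] zero_closed by (auto simp: mpoly_ring_ops)
    next
      fix a :: "'k mpoly" assume a: "a \<in> sr_ideal D \<inter> carrier (mpoly_ring n)"
      then have "\<ominus>\<^bsub>mpoly_ring n\<^esub> a \<in> sr_ideal D \<inter> carrier (mpoly_ring n)"
        using ideal_diff[OF J ideal_zero[OF J], of a] by (auto simp: mpoly_ring_a_inv carrier_mpoly_ring)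
      then show "inv\<^bsub>add_monoid (mpoly_ring n)\<^esub> a \<in> sr_ideal D \<inter> carrier (mpoly_ring n)"
        by (simp add: a_inv_def)
    next
      fix a b :: "'k mpoly"
      assume "a \<in> sr_ideal D \<inter> carrier (mpoly_ring n)" "b \<in> sr_ideal D \<inter> carrier (mpoly_ring n)"
      then show "a \<otimes>\<^bsub>add_monoid (mpoly_ring n)\<^esub> b \<in> sr_ideal D \<inter> carrier (mpoly_ring n)"
        using a_closed[of a b] ideal_add[OF J, of a b] by (simp add: mpoly_ring_ops)
    qed auto
  next
    fix a x :: "'k mpoly" assume "a \<in> sr_ideal D \<inter> carrier (mpoly_ring n)" "x \<in> carrier (mpoly_ring n)"
    then show "x \<otimes>\<^bsub>mpoly_ring n\<^esub> a \<in> sr_ideal D \<inter> carrier (mpoly_ring n)"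
      "a \<otimes>\<^bsub>mpoly_ring n\<^esub> x \<in> sr_ideal D \<inter> carrier (mpoly_ring n)"
      using m_closed[of x a] m_closed[of a x] ideal_mult[OF J, of a x] ideal_mult2[OF J, of a x]
      by (auto simp: mpoly_ring_ops)
  qed (rule ring_axioms)
qed

text \<open>Every nonface contains the support of a generator, so each monomial of the right-hand
  side is a multiple of a generator, with cofactor in the variables up to \<open>n\<close>.\<close>

lemma genideal_vmon:
  assumes D: "down_closed D" and gens: "\<And>A. A \<in> \<A> \<Longrightarrow> A \<subseteq> {1..n} \<and> A \<notin> D"
    and cover: "\<And>H. H \<subseteq> {1..n} \<Longrightarrow> H \<notin> D \<Longrightarrow> \<exists>A\<in>\<A>. A \<subseteq> H"
  shows "Idl\<^bsub>mpoly_ring n\<^esub> (vmon ` \<A>) = sr_ideal D \<inter> carrier (mpoly_ring n :: 'k::field mpoly ring)"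
proof -
  interpret cring "mpoly_ring n :: 'k mpoly ring" by (rule mpoly_ring_is_cring)
  have fin: "finite A" if "A \<in> \<A>" for A using gens[OF that] finite_subset by blast
  have sub: "vmon ` \<A> \<subseteq> sr_ideal D \<inter> carrier (mpoly_ring n :: 'k mpoly ring)"
    using gens fin by (auto simp: vmon_def sr_ideal_def carrier_mpoly_ring keys_indicator_exponent)
  interpret I: ideal "Idl\<^bsub>mpoly_ring n\<^esub> (vmon ` \<A>)" "mpoly_ring n :: 'k mpoly ring"
    using sub by (intro genideal_ideal) auto
  show ?thesis
  proof
    show "Idl\<^bsub>mpoly_ring n\<^esub> (vmon ` \<A>) \<subseteq> sr_ideal D \<inter> carrier (mpoly_ring n :: 'k mpoly ring)"
      by (rule genideal_minimal[OF ideal_sr_ideal_carrier[OF D] sub])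
    show "sr_ideal D \<inter> carrier (mpoly_ring n :: 'k mpoly ring) \<subseteq> Idl\<^bsub>mpoly_ring n\<^esub> (vmon ` \<A>)"
    proof
      fix p :: "'k mpoly" assume p: "p \<in> sr_ideal D \<inter> carrier (mpoly_ring n)"
      have single: "Poly_Mapping.single m c \<in> Idl\<^bsub>mpoly_ring n\<^esub> (vmon ` \<A>)"
        if m: "m \<in> Poly_Mapping.keys p" for m and c :: 'k
      proof -
        have keys: "Poly_Mapping.keys m \<subseteq> {1..n}" "Poly_Mapping.keys m \<notin> D"
          using p m by (auto simp: sr_ideal_def carrier_mpoly_ring)
        from cover[OF this] obtain A where A: "A \<in> \<A>" "A \<subseteq> Poly_Mapping.keys m" by blast
        obtain m' where m': "Poly_Mapping.keys m' \<subseteq> Poly_Mapping.keys m"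
          "Poly_Mapping.single m c = vmon A * Poly_Mapping.single m' c"
          using vmon_dvd_single[OF fin[OF A(1)] A(2)] by blast
        have "vmon A \<in> Idl\<^bsub>mpoly_ring n\<^esub> (vmon ` \<A> :: 'k mpoly set)"
          using genideal_self[of "vmon ` \<A>"] sub A(1) by auto
        moreover have "Poly_Mapping.single m' c \<in> carrier (mpoly_ring n)"
          using m'(1) keys(1) by (auto simp: carrier_mpoly_ring)
        ultimately have "vmon A \<otimes>\<^bsub>mpoly_ring n\<^esub> Poly_Mapping.single m' c \<in> Idl\<^bsub>mpoly_ring n\<^esub> (vmon ` \<A>)"
          by (rule I.I_r_closed)
        then show ?thesis using m'(2) by (simp add: mpoly_ring_ops)
      qed
      have "(\<Sum>m\<in>M. Poly_Mapping.single m (Poly_Mapping.lookup p m)) \<in> Idl\<^bsub>mpoly_ring n\<^esub> (vmon ` \<A>)"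
        if "M \<subseteq> Poly_Mapping.keys p" for M
        using finite_subset[OF that finite_keys] that
      proof (induction M rule: finite_induct)
        case empty
        then show ?case using I.zero_closed by (simp add: mpoly_ring_ops)
      next
        case (insert m M)
        then show ?case using I.a_closed[OF single[of m]] by (simp add: mpoly_ring_ops)
      qed
      from this[OF order.refl] show "p \<in> Idl\<^bsub>mpoly_ring n\<^esub> (vmon ` \<A>)"
        using poly_mapping_sum_singles[of p] by simp
    qed
  qed
qed

text \<open>Iterated adjunction is \<open>J\<close> plus the ideal generated by \<open>fs\<close>,
  in the shape in which \<open>seq_submodule\<close> presents it.\<close>

lemma foldl_adjoin_iff:
  assumes "is_ideal J"
  shows "p \<in> foldl adjoin J fs \<longleftrightarrow> (\<exists>s. p - (\<Sum>i<length fs. fs ! i * s i) \<in> J)"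
proof (induction fs arbitrary: p rule: rev_induct)
  case (snoc f fs)
  have "p \<in> foldl adjoin J (fs @ [f]) \<longleftrightarrow> (\<exists>r. p - f * r \<in> foldl adjoin J fs)"
    by (simp add: adjoin_def)
  also have "\<dots> \<longleftrightarrow> (\<exists>r s. p - f * r - (\<Sum>i<length fs. fs ! i * s i) \<in> J)"
    by (simp add: snoc.IH)
  also have "\<dots> \<longleftrightarrow> (\<exists>s. p - (\<Sum>i<length (fs @ [f]). (fs @ [f]) ! i * s i) \<in> J)"
  proof
    assume "\<exists>r s. p - f * r - (\<Sum>i<length fs. fs ! i * s i) \<in> J"
    then obtain r s where "p - f * r - (\<Sum>i<length fs. fs ! i * s i) \<in> J" by blast
    then show "\<exists>s. p - (\<Sum>i<length (fs @ [f]). (fs @ [f]) ! i * s i) \<in> J"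
      by (intro exI[of _ "s(length fs := r)"]) (simp add: nth_append algebra_simps)
  next
    assume "\<exists>s. p - (\<Sum>i<length (fs @ [f]). (fs @ [f]) ! i * s i) \<in> J"
    then obtain s where "p - (\<Sum>i<length (fs @ [f]). (fs @ [f]) ! i * s i) \<in> J" by blast
    then show "\<exists>r s. p - f * r - (\<Sum>i<length fs. fs ! i * s i) \<in> J"
      by (intro exI[of _ "s (length fs)"] exI[of _ s]) (simp add: nth_append algebra_simps)
  qed
  finally show ?case .
qed simp

lemma ideal_foldl_adjoin: "is_ideal J \<Longrightarrow> is_ideal (foldl adjoin J fs)"
  by (induction fs arbitrary: J) (auto intro: ideal_adjoin)

lemma subset_foldl_adjoin: "J \<subseteq> foldl adjoin J fs"
proof (induction fs arbitrary: J)
  case (Cons f fs)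
  show ?case using ideal_subset_adjoin[of J f] Cons.IH[of "adjoin J f"] by auto
qed simp

lemma weakly_regular_iff:
  "weakly_regular J fs \<longleftrightarrow> (\<forall>i<length fs. nonzerodivisor_mod (foldl adjoin J (take i fs)) (fs ! i))"
proof (induction fs arbitrary: J)
  case (Cons f fs)
  show ?case by (simp add: Cons.IH All_less_Suc2)
qed simp

text \<open>Finite sums depend only on the additive structure, so those of the module are those of
  the quotient ring.\<close>

lemma quotient_ring_simps:
  "carrier (quotient_module R I) = carrier (R Quot I)"
  "finsum (quotient_module R I) g A = finsum (R Quot I) g A"
  "f \<odot>\<^bsub>quotient_module R I\<^esub> Y = (I +>\<^bsub>R\<^esub> f) \<otimes>\<^bsub>R Quot I\<^esub> Y"
  by (simp_all add: quotient_module_def finsum_def finprod_def)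

text \<open>Truncation to the monomials in the first \<open>n\<close> variables turns a statement about all
  polynomials into one about \<open>mpoly_ring n\<close>, because the discarded part lies in \<open>sr_ideal D\<close>.\<close>

lemma sr_ideal_truncate:
  assumes "D \<subseteq> Pow {1..n}"
  obtains p' :: "'k::field mpoly" where "p' \<in> carrier (mpoly_ring n)" "p - p' \<in> sr_ideal D"
proof
  let ?Q = "{m :: nat \<Rightarrow>\<^sub>0 nat. Poly_Mapping.keys m \<subseteq> {1..n}}"
  show "restrict_keys ?Q p \<in> carrier (mpoly_ring n)"
    by (auto simp: carrier_mpoly_ring keys_restrict_keys)
  show "p - restrict_keys ?Q p \<in> sr_ideal D"
    using assms by (auto simp: sr_ideal_def keys_diff_restrict_keys)
qed

text \<open>Bridges cosets over the ring in \<open>n\<close> variables and plain ideals in the ring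
  in all variables. Representatives give one passage, truncation the other.\<close>

theorem regular_sequence_quotient_iff:
  fixes fs :: "'k::field mpoly list"
  assumes D: "down_closed D" "D \<subseteq> Pow {1..n}" and fs: "set fs \<subseteq> carrier (mpoly_ring n)"
  shows "regular_sequence (mpoly_ring n)
      (quotient_module (mpoly_ring n) (sr_ideal D \<inter> carrier (mpoly_ring n))) fs
    \<longleftrightarrow> weakly_regular (sr_ideal D) fs \<and> 1 \<notin> foldl adjoin (sr_ideal D) fs"
proof -
  let ?S = "mpoly_ring n :: 'k mpoly ring" and ?J = "sr_ideal D :: 'k mpoly set"
  let ?I = "?J \<inter> carrier ?S"
  let ?M = "quotient_module ?S ?I"
  interpret R: cring ?S by (rule mpoly_ring_is_cring)
  interpret I: ideal ?I ?S by (rule ideal_sr_ideal_carrier[OF D(1)])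
  interpret h: ring_hom_ring ?S "?S Quot ?I" "(+>\<^bsub>?S\<^esub>) ?I" by (rule I.rcos_ring_hom_ring)
  interpret Q: cring "?S Quot ?I" by (rule I.quotient_is_cring[OF R.is_cring])
  interpret hc: ring_hom_cring ?S "?S Quot ?I" "(+>\<^bsub>?S\<^esub>) ?I"
    by (rule ring_hom_cringI[OF h.ring_hom_ring_axioms R.is_cring Q.is_cring])
  have J: "is_ideal ?J" by (rule ideal_sr_ideal[OF D(1)])
  let ?q = "\<lambda>u. ?I +>\<^bsub>?S\<^esub> u"
  have carrier: "carrier ?M = ?q ` carrier ?S"
    unfolding quotient_ring_simps FactRing_def A_RCOSETS_def' by auto
  have q_eq: "?q u = ?q v \<longleftrightarrow> u - v \<in> ?J" if "u \<in> carrier ?S" "v \<in> carrier ?S" for u v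
  proof -
    have "u \<ominus>\<^bsub>?S\<^esub> v \<in> ?I \<longleftrightarrow> ?q u = ?q v"
      by (rule R.quotient_eq_iff_same_a_r_cos[OF I.is_ideal that])
    moreover have "u \<ominus>\<^bsub>?S\<^esub> v \<in> carrier ?S" using that by simp
    ultimately show ?thesis using that by (simp add: mpoly_ring_a_minus)
  qed
  have comb: "finsum ?M (\<lambda>i. gs ! i \<odot>\<^bsub>?M\<^esub> ?q (s i)) {..<length gs} = ?q (\<Sum>i<length gs. gs ! i * s i)"
    "(\<Sum>i<length gs. gs ! i * s i) \<in> carrier ?S"
    if gs: "set gs \<subseteq> carrier ?S" and s: "s \<in> {..<length gs} \<rightarrow> carrier ?S" for gs s
  proof -
    have gss: "(\<lambda>i. gs ! i * s i) \<in> {..<length gs} \<rightarrow> carrier ?S"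
    proof
      fix i assume "i \<in> {..<length gs}"
      then have "gs ! i \<in> carrier ?S" "s i \<in> carrier ?S" using gs s nth_mem by auto
      then have "gs ! i \<otimes>\<^bsub>?S\<^esub> s i \<in> carrier ?S" by simp
      then show "gs ! i * s i \<in> carrier ?S" by (simp add: mpoly_ring_ops)
    qed
    have "finsum ?M (\<lambda>i. gs ! i \<odot>\<^bsub>?M\<^esub> ?q (s i)) {..<length gs}
        = finsum (?S Quot ?I) (\<lambda>i. ?q (gs ! i * s i)) {..<length gs}"
      unfolding quotient_ring_simps
    proof (rule h.S.finsum_cong')
      show "(\<lambda>i. ?q (gs ! i * s i)) \<in> {..<length gs} \<rightarrow> carrier (?S Quot ?I)"
        using gss h.hom_closed by (auto simp: Pi_iff)
      fix i assume "i \<in> {..<length gs}"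
      then have "gs ! i \<in> carrier ?S" "s i \<in> carrier ?S" using gs s nth_mem by auto
      then show "?q (gs ! i) \<otimes>\<^bsub>?S Quot ?I\<^esub> ?q (s i) = ?q (gs ! i * s i)"
        using h.hom_mult[of "gs ! i" "s i"] by (simp add: mpoly_ring_ops)
    qed simp
    also have "\<dots> = ?q (finsum ?S (\<lambda>i. gs ! i * s i) {..<length gs})"
      using hc.hom_finsum[OF gss] by (simp add: comp_def)
    finally show "finsum ?M (\<lambda>i. gs ! i \<odot>\<^bsub>?M\<^esub> ?q (s i)) {..<length gs} = ?q (\<Sum>i<length gs. gs ! i * s i)"
      by (simp only: finsum_mpoly_ring[OF gss])
    show "(\<Sum>i<length gs. gs ! i * s i) \<in> carrier ?S"
      using R.finsum_closed[OF gss] by (simp only: finsum_mpoly_ring[OF gss])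
  qed
  have mem: "?q u \<in> seq_submodule ?S ?M gs \<longleftrightarrow> u \<in> foldl adjoin ?J gs"
    if gs: "set gs \<subseteq> carrier ?S" and u: "u \<in> carrier ?S" for gs u
  proof
    assume "?q u \<in> seq_submodule ?S ?M gs"
    then obtain U where U: "U \<in> {..<length gs} \<rightarrow> carrier ?M"
      "?q u = finsum ?M (\<lambda>i. gs ! i \<odot>\<^bsub>?M\<^esub> U i) {..<length gs}"
      unfolding seq_submodule_def by blast
    have "\<forall>i\<in>{..<length gs}. \<exists>v\<in>carrier ?S. U i = ?q v"
      using PiE[OF U(1)[unfolded carrier]] by blast
    then obtain s where s: "\<forall>i\<in>{..<length gs}. s i \<in> carrier ?S \<and> U i = ?q (s i)" by metis
    then have s': "s \<in> {..<length gs} \<rightarrow> carrier ?S" by auto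
    have "finsum ?M (\<lambda>i. gs ! i \<odot>\<^bsub>?M\<^esub> U i) {..<length gs}
        = finsum ?M (\<lambda>i. gs ! i \<odot>\<^bsub>?M\<^esub> ?q (s i)) {..<length gs}"
      unfolding quotient_ring_simps
    proof (rule h.S.finsum_cong')
      show "(\<lambda>i. ?q (gs ! i) \<otimes>\<^bsub>?S Quot ?I\<^esub> ?q (s i)) \<in> {..<length gs} \<rightarrow> carrier (?S Quot ?I)"
        using s gs nth_mem by (auto intro!: h.S.m_closed h.hom_closed)
    qed (use s in auto)
    then have "u - (\<Sum>i<length gs. gs ! i * s i) \<in> ?J"
      using U(2) comb[OF gs s'] q_eq[OF u comb(2)[OF gs s']] by simp
    then show "u \<in> foldl adjoin ?J gs" unfolding foldl_adjoin_iff[OF J] by blast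
  next
    assume "u \<in> foldl adjoin ?J gs"
    then obtain s where s: "u - (\<Sum>i<length gs. gs ! i * s i) \<in> ?J"
      unfolding foldl_adjoin_iff[OF J] by blast
    \<comment> \<open>The coefficients may use foreign variables; truncating them changes the
      combination only by an element of the ideal.\<close>
    have "\<exists>p'. p' \<in> carrier ?S \<and> s i - p' \<in> ?J" for i
      using sr_ideal_truncate[OF D(2)] by metis
    then obtain s' where s': "\<And>i. s' i \<in> carrier ?S" "\<And>i. s i - s' i \<in> ?J" by metis
    have "u - (\<Sum>i<length gs. gs ! i * s' i)
        = (u - (\<Sum>i<length gs. gs ! i * s i)) + (\<Sum>i<length gs. gs ! i * (s i - s' i))"
      by (simp add: algebra_simps sum_subtractf)
    also have "\<dots> \<in> ?J" by (intro ideal_add[OF J] s ideal_sum[OF J] ideal_mult[OF J] s')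
    finally have "?q u = finsum ?M (\<lambda>i. gs ! i \<odot>\<^bsub>?M\<^esub> ?q (s' i)) {..<length gs}"
      using comb[OF gs, of s'] q_eq[OF u comb(2)[OF gs, of s']] s'(1) by auto
    moreover have "(\<lambda>i. ?q (s' i)) \<in> {..<length gs} \<rightarrow> carrier ?M"
      using s'(1) carrier by auto
    ultimately show "?q u \<in> seq_submodule ?S ?M gs"
      unfolding seq_submodule_def mem_Collect_eq by (intro exI[of _ "\<lambda>i. ?q (s' i)"] conjI)
  qed
  have nzd: "(\<forall>U\<in>carrier ?M. f \<odot>\<^bsub>?M\<^esub> U \<in> seq_submodule ?S ?M gs \<longrightarrow> U \<in> seq_submodule ?S ?M gs)
      \<longleftrightarrow> nonzerodivisor_mod (foldl adjoin ?J gs) f"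
    if gs: "set gs \<subseteq> carrier ?S" and f: "f \<in> carrier ?S" for gs f
  proof -
    let ?J' = "foldl adjoin ?J gs"
    have J': "is_ideal ?J'" by (rule ideal_foldl_adjoin[OF J])
    have smult: "f \<odot>\<^bsub>?M\<^esub> ?q u = ?q (f * u)" "f * u \<in> carrier ?S" if "u \<in> carrier ?S" for u
      using h.hom_mult[OF f that] R.m_closed[OF f that]
      by (simp_all add: quotient_ring_simps mpoly_ring_ops)
    have "(\<forall>U\<in>carrier ?M. f \<odot>\<^bsub>?M\<^esub> U \<in> seq_submodule ?S ?M gs \<longrightarrow> U \<in> seq_submodule ?S ?M gs)
        \<longleftrightarrow> (\<forall>u\<in>carrier ?S. f * u \<in> ?J' \<longrightarrow> u \<in> ?J')"
      unfolding carrier ball_simps using smult mem[OF gs] by simp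
    also have "\<dots> \<longleftrightarrow> nonzerodivisor_mod ?J' f"
    proof
      assume *: "\<forall>u\<in>carrier ?S. f * u \<in> ?J' \<longrightarrow> u \<in> ?J'"
      show "nonzerodivisor_mod ?J' f"
        unfolding nonzerodivisor_mod_def
      proof (intro allI impI)
        fix u assume fu: "f * u \<in> ?J'"
        obtain u' where u': "u' \<in> carrier ?S" "u - u' \<in> ?J" using sr_ideal_truncate[OF D(2)] by blast
        then have d: "u - u' \<in> ?J'" using subset_foldl_adjoin by blast
        have "f * u' = f * u - f * (u - u')" by (simp add: algebra_simps)
        also have "\<dots> \<in> ?J'" by (intro ideal_diff[OF J'] fu ideal_mult[OF J'] d)
        finally have "u' \<in> ?J'" using * u'(1) by blast
        from ideal_add[OF J' d this] show "u \<in> ?J'" by simp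
      qed
    next
      assume "nonzerodivisor_mod ?J' f"
      then show "\<forall>u\<in>carrier ?S. f * u \<in> ?J' \<longrightarrow> u \<in> ?J'" using nonzerodivisor_modD by blast
    qed
    finally show ?thesis .
  qed
  have "(\<forall>i<length fs. \<forall>U\<in>carrier ?M. (fs ! i) \<odot>\<^bsub>?M\<^esub> U \<in> seq_submodule ?S ?M (take i fs)
      \<longrightarrow> U \<in> seq_submodule ?S ?M (take i fs)) \<longleftrightarrow> weakly_regular ?J fs"
    unfolding weakly_regular_iff
  proof (intro all_cong)
    fix i assume "i < length fs"
    then have "set (take i fs) \<subseteq> carrier ?S" "fs ! i \<in> carrier ?S"
      using fs set_take_subset[of i fs] by auto
    then show "(\<forall>U\<in>carrier ?M. (fs ! i) \<odot>\<^bsub>?M\<^esub> U \<in> seq_submodule ?S ?M (take i fs)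
        \<longrightarrow> U \<in> seq_submodule ?S ?M (take i fs))
      \<longleftrightarrow> nonzerodivisor_mod (foldl adjoin ?J (take i fs)) (fs ! i)" by (rule nzd)
  qed
  moreover have "seq_submodule ?S ?M fs \<noteq> carrier ?M \<longleftrightarrow> 1 \<notin> foldl adjoin ?J fs"
  proof -
    let ?J' = "foldl adjoin ?J fs"
    have J': "is_ideal ?J'" by (rule ideal_foldl_adjoin[OF J])
    have one: "1 \<in> carrier ?S" using R.one_closed by (simp add: mpoly_ring_ops)
    have "seq_submodule ?S ?M fs \<subseteq> carrier ?M"
    proof
      fix Y assume "Y \<in> seq_submodule ?S ?M fs"
      then obtain U where U: "U \<in> {..<length fs} \<rightarrow> carrier ?M"
        "Y = finsum ?M (\<lambda>i. fs ! i \<odot>\<^bsub>?M\<^esub> U i) {..<length fs}"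
        unfolding seq_submodule_def by blast
      show "Y \<in> carrier ?M"
        unfolding U(2) quotient_ring_simps
        using U(1) fs nth_mem
        by (intro h.S.finsum_closed) (auto simp: quotient_ring_simps intro!: h.S.m_closed h.hom_closed)
    qed
    then have "seq_submodule ?S ?M fs = carrier ?M \<longleftrightarrow> (\<forall>u\<in>carrier ?S. ?q u \<in> seq_submodule ?S ?M fs)"
      unfolding carrier by auto
    also have "\<dots> \<longleftrightarrow> (\<forall>u\<in>carrier ?S. u \<in> ?J')" using mem[OF fs] by simp
    also have "\<dots> \<longleftrightarrow> 1 \<in> ?J'"
      using one ideal_mult[OF J', of 1] by (metis mult.right_neutral)
    finally show ?thesis by simp
  qed
  ultimately show ?thesis using fs unfolding regular_sequence_def by simp
qed

section \<open>The depth of the 3-path ideal\<close>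

lemma mvar_eq_vmon: "mvar i = vmon {i}"
  by (simp add: mvar_def vmon_def indicator_exponent_def)

lemma mvar_mult3_eq_vmon: "distinct [a, b, c] \<Longrightarrow> mvar a * mvar b * mvar c = vmon {a, b, c}"
  by (simp add: mvar_def vmon_def indicator_exponent_def mult_single add.assoc)

text \<open>The Stanley--Reisner ideal of the complex whose only face is empty; its minimal nonfaces
  are the single vertices.\<close>

lemma graded_maximal_ideal_eq:
  "graded_maximal_ideal n = sr_ideal {{}} \<inter> carrier (mpoly_ring n :: 'k::field mpoly ring)"
proof -
  have "(mvar ` {1..n} :: 'k mpoly set) = vmon ` ((\<lambda>i. {i}) ` {1..n})"
    by (simp add: image_image mvar_eq_vmon)
  then show ?thesis
    unfolding graded_maximal_ideal_def
    by (simp only:) (rule genideal_vmon, auto simp: down_closed_def)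
qed

lemma sr_ideal_maximal_iff: "p \<in> sr_ideal {{}} \<longleftrightarrow> order_ge 1 p"
proof -
  have "Poly_Mapping.keys m = {} \<longleftrightarrow> total_degree m = 0" for m
    by (fastforce simp: total_degree_def in_keys_iff simp del: keys_eq_empty)
  then show ?thesis by (auto simp: sr_ideal_def order_ge_def Suc_le_eq)
qed

lemma down_closed_face_link: "down_closed (face_link {} V)"
  using path_free_mono by (auto simp: down_closed_def face_link_def)

text \<open>Sorting a path \<open>a, b, c\<close> keeps consecutive distances at most 2: if the
  middle vertex \<open>b\<close> is extremal in the order, the other two are both within 2 of it on
  the same side.\<close>

lemma not_path_free_iff:
  "\<not> path_free H \<longleftrightarrow> (\<exists>a b c. distinct [a, b, c] \<and> {a, b, c} \<subseteq> H
     \<and> (b = a + 1 \<or> b = a + 2 \<or> a = b + 1 \<or> a = b + 2)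
     \<and> (c = b + 1 \<or> c = b + 2 \<or> b = c + 1 \<or> b = c + 2))"
proof
  assume "\<not> path_free H"
  then obtain a b c where "a \<in> H" "b \<in> H" "c \<in> H" "a < b" "b < c" "b \<le> a + 2" "c \<le> b + 2"
    unfolding path_free_def by blast
  then show "\<exists>a b c. distinct [a, b, c] \<and> {a, b, c} \<subseteq> H
     \<and> (b = a + 1 \<or> b = a + 2 \<or> a = b + 1 \<or> a = b + 2)
     \<and> (c = b + 1 \<or> c = b + 2 \<or> b = c + 1 \<or> b = c + 2)"
    by (intro exI[of _ a] exI[of _ b] exI[of _ c]) auto
next
  assume "\<exists>a b c. distinct [a, b, c] \<and> {a, b, c} \<subseteq> H
     \<and> (b = a + 1 \<or> b = a + 2 \<or> a = b + 1 \<or> a = b + 2)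
     \<and> (c = b + 1 \<or> c = b + 2 \<or> b = c + 1 \<or> b = c + 2)"
  then obtain a b c where abc: "distinct [a, b, c]" "{a, b, c} \<subseteq> H"
    and ab: "b = a + 1 \<or> b = a + 2 \<or> a = b + 1 \<or> a = b + 2"
    and bc: "c = b + 1 \<or> c = b + 2 \<or> b = c + 1 \<or> b = c + 2" by blast
  have "\<not> path_free {a, b, c}"
    using ab bc abc(1) by (elim disjE) (simp_all add: path_free_def)
  then show "\<not> path_free H" using path_free_mono abc(2) by blast
qed

lemma path3_ideal_eq:
  "path3_ideal n (path_square_edges n)
    = sr_ideal (face_link {} {1..n}) \<inter> carrier (mpoly_ring n :: 'k::field mpoly ring)"
proof -
  let ?P = "\<lambda>a b c. a \<in> {1..n} \<and> b \<in> {1..n} \<and> c \<in> {1..n} \<and> distinct [a, b, c]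
    \<and> {a, b} \<in> path_square_edges n \<and> {b, c} \<in> path_square_edges n"
  have "{mvar a * mvar b * mvar c | a b c. ?P a b c} = (vmon ` {{a, b, c} | a b c. ?P a b c} :: 'k mpoly set)"
    (is "?L = ?R")
  proof (intro equalityI subsetI)
    fix p assume "p \<in> ?L"
    then obtain a b c where abc: "?P a b c" "p = mvar a * mvar b * mvar c" by blast
    then have "p = vmon {a, b, c}" by (simp add: mvar_mult3_eq_vmon)
    then show "p \<in> ?R" using abc(1) by blast
  next
    fix p assume "p \<in> ?R"
    then obtain a b c where abc: "?P a b c" "p = vmon {a, b, c}" by blast
    then have "p = mvar a * mvar b * mvar c" by (simp add: mvar_mult3_eq_vmon)
    then show "p \<in> ?L" using abc(1) by blast
  qed
  moreover have "Idl\<^bsub>mpoly_ring n\<^esub> ?R = sr_ideal (face_link {} {1..n}) \<inter> carrier (mpoly_ring n)"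
  proof (rule genideal_vmon[OF down_closed_face_link])
    fix A assume "A \<in> {{a, b, c} | a b c. ?P a b c}"
    then obtain a b c where abc: "?P a b c" "A = {a, b, c}" by blast
    then have "\<not> path_free A"
      unfolding not_path_free_iff path_square_edges_iff
      by (intro exI[of _ a] exI[of _ b] exI[of _ c]) simp
    then show "A \<subseteq> {1..n} \<and> A \<notin> face_link {} {1..n}" using abc by (simp add: face_link_def)
  next
    fix H assume H: "H \<subseteq> {1..n}" "H \<notin> face_link {} {1..n}"
    then have "\<not> path_free H" by (simp add: face_link_def)
    then obtain a b c where abc: "distinct [a, b, c]" "{a, b, c} \<subseteq> H"
      "b = a + 1 \<or> b = a + 2 \<or> a = b + 1 \<or> a = b + 2"
      "c = b + 1 \<or> c = b + 2 \<or> b = c + 1 \<or> b = c + 2"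
      unfolding not_path_free_iff by blast
    moreover have "a \<in> {1..n}" "b \<in> {1..n}" "c \<in> {1..n}" using abc(2) H(1) by auto
    ultimately have "?P a b c" by (simp add: path_square_edges_iff)
    then show "\<exists>A\<in>{{a, b, c} | a b c. ?P a b c}. A \<subseteq> H" using abc(2) by blast
  qed
  ultimately show ?thesis by (simp only: path3_ideal_def)
qed

lemma esyms_properties:
  assumes "f \<in> set (esyms {1..n} t :: 'k::field mpoly list)"
  shows "f \<in> carrier (mpoly_ring n)" "order_ge 1 f"
proof -
  from assms obtain i where i: "f = esym {1..n} (Suc i)" by (induction t) auto
  show "order_ge 1 f"
    using homogeneous_esym[of "{1..n}" "Suc i"] by (auto simp: i homogeneous_def order_ge_def)
  show "f \<in> carrier (mpoly_ring n)"
    unfolding carrier_mpoly_ring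
  proof
    fix m assume "m \<in> Poly_Mapping.keys f"
    then have "m \<in> Poly_Mapping.keys (\<Sum>A | A \<subseteq> {1..n} \<and> card A = Suc i. vmon A :: 'k mpoly)"
      by (simp only: i esym_def)
    from subsetD[OF keys_sum this]
    obtain A where A: "A \<subseteq> {1..n}" "m \<in> Poly_Mapping.keys (vmon A :: 'k mpoly)" by auto
    then have "finite A" using finite_subset by blast
    then show "Poly_Mapping.keys m \<subseteq> {1..n}"
      using A by (simp add: vmon_def keys_indicator_exponent)
  qed
qed

lemma depth_path3_ideal:
  "depth (mpoly_ring n :: 'k::field mpoly ring) (graded_maximal_ideal n)
     (quotient_module (mpoly_ring n) (path3_ideal n (path_square_edges n))) = enat (path_depth n)"
proof -
  let ?S = "mpoly_ring n :: 'k mpoly ring" and ?D = "face_link {} {1..n}"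
  let ?M = "quotient_module ?S (path3_ideal n (path_square_edges n))"
  have D: "down_closed ?D" "?D \<subseteq> Pow {1..n}"
    by (rule down_closed_face_link) (auto simp: face_link_def)
  have regular_iff: "regular_sequence ?S ?M fs \<longleftrightarrow>
      weakly_regular (sr_ideal ?D) fs \<and> 1 \<notin> foldl adjoin (sr_ideal ?D) fs"
    if "set fs \<subseteq> carrier ?S" for fs
    unfolding path3_ideal_eq by (rule regular_sequence_quotient_iff[OF D that])
  show ?thesis
    unfolding depth_def
  proof (intro antisym SUP_least)
    fix fs assume "fs \<in> {fs. set fs \<subseteq> graded_maximal_ideal n \<and> regular_sequence ?S ?M fs}"
    then have fs: "set fs \<subseteq> graded_maximal_ideal n" "regular_sequence ?S ?M fs" by auto
    from fs(1) have carrier: "set fs \<subseteq> carrier ?S" and order: "\<forall>f\<in>set fs. order_ge 1 f"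
      unfolding graded_maximal_ideal_eq using sr_ideal_maximal_iff by auto
    \<comment> \<open>Upper bound, from the small facet.\<close>
    obtain F where F: "F \<subseteq> {1..n}" "path_free F" "card F = path_depth n"
      "\<forall>v\<in>{1..n} - F. \<not> path_free (insert v F)"
      using path_free_maximal_face[of n] by blast
    have "length fs \<le> card F"
    proof (rule weakly_regular_length_le[OF D(1)])
      show "finite F" using F(1) finite_subset by blast
      show "F \<in> ?D" using F by (simp add: face_link_def)
      show "insert v F \<notin> ?D" if "v \<notin> F" for v using F(4) that by (auto simp: face_link_def)
      show "weakly_regular (sr_ideal ?D) fs" using fs(2) regular_iff[OF carrier] by simp
    qed (rule order)
    then show "enat (length fs) \<le> enat (path_depth n)" using F(3) by simp
  next
    \<comment> \<open>Lower bound, attained by the elementary symmetric polynomials. Properness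
      holds because no element of the resulting ideal has a constant term.\<close>
    let ?fs = "esyms {1..n} (path_depth n) :: 'k mpoly list"
    have carrier: "set ?fs \<subseteq> carrier ?S" using esyms_properties(1) by blast
    have "splits_into_faces (path_depth n) ?D"
      using splits_into_faces_path[of "{}" 1 "path_depth n" n] by (simp add: path_free_def)
    then have "weakly_regular (sr_ideal ?D) ?fs"
      by (intro weakly_regular_esyms D) simp
    moreover have "1 \<notin> foldl adjoin (sr_ideal ?D) ?fs"
    proof
      assume "1 \<in> foldl adjoin (sr_ideal ?D) ?fs"
      moreover have "{} \<in> ?D" by (simp add: face_link_def path_free_def)
      then have "\<forall>p\<in>sr_ideal ?D. 0 \<notin> Poly_Mapping.keys (p :: 'k mpoly)"
        by (auto simp: sr_ideal_def)
      then have "\<forall>p\<in>sr_ideal ?D. Poly_Mapping.lookup (p :: 'k mpoly) 0 = 0"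
        by (simp add: in_keys_iff)
      moreover have "\<forall>f\<in>set ?fs. order_ge (Suc (total_degree 0)) f"
        using esyms_properties(2)[where 'k = 'k] by (auto simp: total_degree_def)
      ultimately have "Poly_Mapping.lookup (1 :: 'k mpoly) 0 = 0"
        by (intro foldl_adjoin_coefficient_zero)
      then show False by simp
    qed
    ultimately have "regular_sequence ?S ?M ?fs" using regular_iff[OF carrier] by simp
    moreover have "set ?fs \<subseteq> graded_maximal_ideal n"
      using carrier esyms_properties(2) by (auto simp: graded_maximal_ideal_eq sr_ideal_maximal_iff)
    ultimately have "enat (length ?fs) \<le> (SUP fs\<in>{fs. set fs \<subseteq> graded_maximal_ideal n
        \<and> regular_sequence ?S ?M fs}. enat (length fs))"
      by (intro SUP_upper) simp
    then show "enat (path_depth n) \<le> (SUP fs\<in>{fs. set fs \<subseteq> graded_maximal_ideal n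
        \<and> regular_sequence ?S ?M fs}. enat (length fs))"
      by (simp add: length_esyms)
  qed
qed

text \<open>Adding 6 before dividing by 7 computes the ceiling, and
  \<open>n + 5 = (n - 2) + 7\<close> extracts the final summand 1.\<close>

lemma path_depth_eq:
  assumes "n \<ge> 2"
  shows "nat (\<lceil>real n / 7\<rceil> + \<lfloor>(real n - 2) / 7\<rfloor> + 1) = path_depth n"
proof -
  have "\<lceil>real n / 7\<rceil> = int ((n + 6) div 7)"
  proof (rule ceiling_unique)
    have "7 * ((n + 6) div 7) < n + 7" "n \<le> 7 * ((n + 6) div 7)" by linarith+
    then show "of_int (int ((n + 6) div 7)) - 1 < real n / 7" "real n / 7 \<le> of_int (int ((n + 6) div 7))"
      by linarith+
  qed
  moreover have "\<lfloor>(real n - 2) / 7\<rfloor> = int ((n - 2) div 7)"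
    using floor_divide_of_nat_eq[of "n - 2" 7, where 'a = real] assms by (simp add: of_nat_diff)
  moreover have "(n + 5) div 7 = (n - 2) div 7 + 1"
    using div_add_self2[of 7 "n - 2"] assms by simp
  ultimately show ?thesis unfolding path_depth_def by linarith
qed

theorem theorem2p4:
  fixes n :: nat
  assumes "n \<ge> 2"
  shows "depth (mpoly_ring n :: 'k::field mpoly ring) (graded_maximal_ideal n)
           (quotient_module (mpoly_ring n) (path3_ideal n (path_square_edges n)))
         = enat (nat (\<lceil>real n / 7\<rceil> + \<lfloor>(real n - 2) / 7\<rfloor> + 1))"
  by (simp only: depth_path3_ideal path_depth_eq[OF assms])

end
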